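(* Let $\Gamma\Rightarrow\Delta$ be a sequent. If its structural Skolemization $(\Gamma\Rightarrow\Delta)^S$ is derivable in $\mathbf{LJ}^{++}$ by a cut-free proof using only atomic axioms, then $\Gamma\Rightarrow\Delta$ is cut-free $\mathbf{LJ}^{++}$-derivable.
   Context: Sequents are $\Gamma\Rightarrow\Delta$ with finite multisets of first-order formulas. $\mathbf{LK}$ is the usual first-order sequent calculus (axioms $p\Rightarrow p$, $p$ atomic, and $\bot\Rightarrow$; weakening, contraction, standard propositional rules, quantifier rules $(\forall L),(\exists R)$ with terms, $(\forall R),(\exists L)$ with eigenvariable condition, cut); $\mathbf{LJ}$ is its single-conclusion version. Rules $(\forall R),(\exists L)$ are strong-quantifier inferences and their eigen-variable $a$ is the characteristic variable. In a proof $\pi$, $a<_\pi b$ if $\pi$ contains a strong-quantifier inference from $\Gamma\Rightarrow A(a,b,\vec c)$ to $\Gamma\Rightarrow\forall xA(x,b,\vec c)$ or from $A(a,b,\vec c),\Gamma\Rightarrow\Delta$ to $\exists xA(x,b,\vec c),\Gamma\Rightarrow\Delta$. A quantifier inference is suitable for $\pi$ if it is a weak-quantifier inference, or its characteristic variable does not occur in the end-sequent of $\pi$, $<_\pi$ is acyclic, and any two strong-quantifier inferences with the same characteristic variable have the same principal formula. $\mathbf{LJ}^{++}$ is $\mathbf{LJ}$ without the eigenvariable condition, restricted to proofs all of whose quantifier inferences are suitable. Strong quantifiers: positive $\forall$ or negative $\exists$ (positive = in the antecedent of an even number of implications); structural Skolemization $F^S$ of a closed formula replaces successively the first strong quantifier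 $(Qy)$ by deleting it and substituting $f(x_1,\dots,x_n)$ for $y$, where $x_1,\dots,x_n$ are the variables of the weak quantifiers dominating it and $f$ is fresh. For a sequent, with $F=\bigwedge\Gamma\to\bigvee\Delta$ and $F^S=\bigwedge\Pi\to\bigvee\Lambda$, $(\Gamma\Rightarrow\Delta)^S:=\Pi\Rightarrow\Lambda$. *)

theory Defs
  imports "HOL-Library.Multiset"
begin

text \<open>First-order syntax in locally nameless form: free variables (which serve as characteristic
  variables) are named, bound variables are de Bruijn indices. A function or predicate symbol
  is a name together with the number of arguments it is applied to.\<close>

datatype 'f tm = Free nat | Bound nat | Fun 'f "'f tm list"

datatype ('f, 'p) fm =
    Bot
  | Pre 'p "'f tm list"
  | And "('f, 'p) fm" "('f, 'p) fm"
  | Or "('f, 'p) fm" "('f, 'p) fm"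
  | Imp "('f, 'p) fm" "('f, 'p) fm"
  | All "('f, 'p) fm"
  | Ex "('f, 'p) fm"

fun is_atom :: "('f, 'p) fm \<Rightarrow> bool" where
  "is_atom (Pre _ _) = True"
| "is_atom _ = False"

text \<open>All indices are smaller than \<open>k\<close>, respectively point to a quantifier of the formula or to
  one of \<open>k\<close> quantifiers outside of it. For \<open>k = 0\<close> there is no dangling index.\<close>

primrec lc_tm :: "nat \<Rightarrow> 'f tm \<Rightarrow> bool" where
  "lc_tm k (Free a) \<longleftrightarrow> True"
| "lc_tm k (Bound i) \<longleftrightarrow> i < k"
| "lc_tm k (Fun f ts) \<longleftrightarrow> list_all (lc_tm k) ts"

primrec lc :: "nat \<Rightarrow> ('f, 'p) fm \<Rightarrow> bool" where
  "lc k Bot \<longleftrightarrow> True"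
| "lc k (Pre p ts) \<longleftrightarrow> list_all (lc_tm k) ts"
| "lc k (And A B) \<longleftrightarrow> lc k A \<and> lc k B"
| "lc k (Or A B) \<longleftrightarrow> lc k A \<and> lc k B"
| "lc k (Imp A B) \<longleftrightarrow> lc k A \<and> lc k B"
| "lc k (All A) \<longleftrightarrow> lc (Suc k) A"
| "lc k (Ex A) \<longleftrightarrow> lc (Suc k) A"

primrec fv_tm :: "'f tm \<Rightarrow> nat set" where
  "fv_tm (Free a) = {a}"
| "fv_tm (Bound i) = {}"
| "fv_tm (Fun f ts) = \<Union> (set (map fv_tm ts))"

primrec fv :: "('f, 'p) fm \<Rightarrow> nat set" where
  "fv Bot = {}"
| "fv (Pre p ts) = (\<Union>t\<in>set ts. fv_tm t)"
| "fv (And A B) = fv A \<union> fv B"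
| "fv (Or A B) = fv A \<union> fv B"
| "fv (Imp A B) = fv A \<union> fv B"
| "fv (All A) = fv A"
| "fv (Ex A) = fv A"

primrec funs_tm :: "'f tm \<Rightarrow> 'f set" where
  "funs_tm (Free a) = {}"
| "funs_tm (Bound i) = {}"
| "funs_tm (Fun f ts) = insert f (\<Union> (set (map funs_tm ts)))"

primrec funs :: "('f, 'p) fm \<Rightarrow> 'f set" where
  "funs Bot = {}"
| "funs (Pre p ts) = (\<Union>t\<in>set ts. funs_tm t)"
| "funs (And A B) = funs A \<union> funs B"
| "funs (Or A B) = funs A \<union> funs B"
| "funs (Imp A B) = funs A \<union> funs B"
| "funs (All A) = funs A"
| "funs (Ex A) = funs A"

definition closed_fm :: "('f, 'p) fm \<Rightarrow> bool" where
  "closed_fm A \<longleftrightarrow> lc 0 A \<and> fv A = {}"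

primrec shift_tm :: "nat \<Rightarrow> 'f tm \<Rightarrow> 'f tm" where
  "shift_tm k (Free a) = Free a"
| "shift_tm k (Bound i) = Bound (i + k)"
| "shift_tm k (Fun f ts) = Fun f (map (shift_tm k) ts)"

text \<open>\<open>inst 0 t A\<close> is \<open>A(t)\<close> if \<open>A\<close> is the body of a quantified formula: the index of the
  removed quantifier is replaced by \<open>t\<close>, indices pointing further out are decremented. The term
  may contain dangling indices (as Skolem terms below do); these are adjusted under
  quantifiers, so that nothing is captured.\<close>

primrec inst_tm :: "nat \<Rightarrow> 'f tm \<Rightarrow> 'f tm \<Rightarrow> 'f tm" where
  "inst_tm k t (Free a) = Free a"
| "inst_tm k t (Bound i) = (if i < k then Bound i else if i = k then shift_tm k t else Bound (i - 1))"
| "inst_tm k t (Fun f ts) = Fun f (map (inst_tm k t) ts)"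

primrec inst :: "nat \<Rightarrow> 'f tm \<Rightarrow> ('f, 'p) fm \<Rightarrow> ('f, 'p) fm" where
  "inst k t Bot = Bot"
| "inst k t (Pre p ts) = Pre p (map (inst_tm k t) ts)"
| "inst k t (And A B) = And (inst k t A) (inst k t B)"
| "inst k t (Or A B) = Or (inst k t A) (inst k t B)"
| "inst k t (Imp A B) = Imp (inst k t A) (inst k t B)"
| "inst k t (All A) = All (inst (Suc k) t A)"
| "inst k t (Ex A) = Ex (inst (Suc k) t A)"

datatype ('f, 'p) sequent =
  Sequent (antecedent: "('f, 'p) fm multiset") (succedent: "('f, 'p) fm multiset")
    (infix "\<turnstile>" 50)

fun fv_seq :: "('f, 'p) sequent \<Rightarrow> nat set" where
  "fv_seq (\<Gamma> \<turnstile> \<Delta>) = (\<Union>A\<in>set_mset (\<Gamma> + \<Delta>). fv A)"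

fun lc_seq :: "('f, 'p) sequent \<Rightarrow> bool" where
  "lc_seq (\<Gamma> \<turnstile> \<Delta>) \<longleftrightarrow> (\<forall>A\<in>set_mset (\<Gamma> + \<Delta>). lc 0 A)"

text \<open>Names of inferences. A quantifier inference also records the body of its principal formula
  and the term, respectively the characteristic variable.\<close>

datatype ('f, 'p) rule =
    AxAtom | AxBot
  | WeakL | WeakR | ContrL | ContrR
  | AndL1 | AndL2 | AndR | OrL | OrR1 | OrR2 | ImpL | ImpR
  | AllL "('f, 'p) fm" "'f tm" | AllR "('f, 'p) fm" nat
  | ExL "('f, 'p) fm" nat | ExR "('f, 'p) fm" "'f tm"
  | Cut

text \<open>The inferences of \<open>\<^bold>L\<^bold>K\<close> without the eigenvariable condition: name, premises, conclusion.
  Negation is \<open>A \<rightarrow> \<bottom>\<close>.\<close>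

inductive lk_inference ::
  "('f, 'p) rule \<Rightarrow> ('f, 'p) sequent list \<Rightarrow> ('f, 'p) sequent \<Rightarrow> bool" where
  "is_atom A \<Longrightarrow> lk_inference AxAtom [] ({#A#} \<turnstile> {#A#})"
| "lk_inference AxBot [] ({#Bot#} \<turnstile> {#})"
| "lk_inference WeakL [\<Gamma> \<turnstile> \<Delta>] (add_mset A \<Gamma> \<turnstile> \<Delta>)"
| "lk_inference WeakR [\<Gamma> \<turnstile> \<Delta>] (\<Gamma> \<turnstile> add_mset A \<Delta>)"
| "lk_inference ContrL [add_mset A (add_mset A \<Gamma>) \<turnstile> \<Delta>] (add_mset A \<Gamma> \<turnstile> \<Delta>)"
| "lk_inference ContrR [\<Gamma> \<turnstile> add_mset A (add_mset A \<Delta>)] (\<Gamma> \<turnstile> add_mset A \<Delta>)"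
| "lk_inference AndL1 [add_mset A \<Gamma> \<turnstile> \<Delta>] (add_mset (And A B) \<Gamma> \<turnstile> \<Delta>)"
| "lk_inference AndL2 [add_mset B \<Gamma> \<turnstile> \<Delta>] (add_mset (And A B) \<Gamma> \<turnstile> \<Delta>)"
| "lk_inference AndR [\<Gamma> \<turnstile> add_mset A \<Delta>, \<Gamma> \<turnstile> add_mset B \<Delta>] (\<Gamma> \<turnstile> add_mset (And A B) \<Delta>)"
| "lk_inference OrL [add_mset A \<Gamma> \<turnstile> \<Delta>, add_mset B \<Gamma> \<turnstile> \<Delta>] (add_mset (Or A B) \<Gamma> \<turnstile> \<Delta>)"
| "lk_inference OrR1 [\<Gamma> \<turnstile> add_mset A \<Delta>] (\<Gamma> \<turnstile> add_mset (Or A B) \<Delta>)"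
| "lk_inference OrR2 [\<Gamma> \<turnstile> add_mset B \<Delta>] (\<Gamma> \<turnstile> add_mset (Or A B) \<Delta>)"
| "lk_inference ImpL [\<Gamma> \<turnstile> add_mset A \<Delta>, add_mset B \<Pi> \<turnstile> \<Lambda>] (add_mset (Imp A B) (\<Gamma> + \<Pi>) \<turnstile> \<Delta> + \<Lambda>)"
| "lk_inference ImpR [add_mset A \<Gamma> \<turnstile> add_mset B \<Delta>] (\<Gamma> \<turnstile> add_mset (Imp A B) \<Delta>)"
| "lc_tm 0 t \<Longrightarrow>
    lk_inference (AllL A t) [add_mset (inst 0 t A) \<Gamma> \<turnstile> \<Delta>] (add_mset (All A) \<Gamma> \<turnstile> \<Delta>)"
| "lk_inference (AllR A a) [\<Gamma> \<turnstile> add_mset (inst 0 (Free a) A) \<Delta>] (\<Gamma> \<turnstile> add_mset (All A) \<Delta>)"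
| "lk_inference (ExL A a) [add_mset (inst 0 (Free a) A) \<Gamma> \<turnstile> \<Delta>] (add_mset (Ex A) \<Gamma> \<turnstile> \<Delta>)"
| "lc_tm 0 t \<Longrightarrow>
    lk_inference (ExR A t) [\<Gamma> \<turnstile> add_mset (inst 0 t A) \<Delta>] (\<Gamma> \<turnstile> add_mset (Ex A) \<Delta>)"
| "lk_inference Cut [\<Gamma> \<turnstile> add_mset A \<Delta>, add_mset A \<Pi> \<turnstile> \<Lambda>] (\<Gamma> + \<Pi> \<turnstile> \<Delta> + \<Lambda>)"

datatype ('f, 'p) ptree =
  Infer "('f, 'p) rule" "('f, 'p) ptree list" (end_sequent: "('f, 'p) sequent")

primrec rules :: "('f, 'p) ptree \<Rightarrow> ('f, 'p) rule set" where
  "rules (Infer r \<pi>s S) = insert r (\<Union> (set (map rules \<pi>s)))"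

primrec initial_sequents :: "('f, 'p) ptree \<Rightarrow> ('f, 'p) sequent set" where
  "initial_sequents (Infer r \<pi>s S) =
    (if \<pi>s = [] then {S} else \<Union> (set (map initial_sequents \<pi>s)))"

text \<open>Derivations of \<open>\<^bold>L\<^bold>J\<close> without the eigenvariable condition: derivations of \<open>\<^bold>L\<^bold>K\<close> in which every
  succedent contains at most one formula.\<close>

primrec lj_tree :: "('f, 'p) ptree \<Rightarrow> bool" where
  "lj_tree (Infer r \<pi>s S) \<longleftrightarrow>
    lk_inference r (map end_sequent \<pi>s) S \<and> lc_seq S \<and> size (succedent S) \<le> 1 \<and>
    list_all lj_tree \<pi>s"

fun weak_quantifier_rule :: "('f, 'p) rule \<Rightarrow> bool" where
  "weak_quantifier_rule (AllL _ _) = True"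
| "weak_quantifier_rule (ExR _ _) = True"
| "weak_quantifier_rule _ = False"

text \<open>Characteristic variable and principal formula.\<close>

fun strong_quantifier_rule :: "('f, 'p) rule \<Rightarrow> (nat \<times> ('f, 'p) fm) option" where
  "strong_quantifier_rule (AllR A a) = Some (a, All A)"
| "strong_quantifier_rule (ExL A a) = Some (a, Ex A)"
| "strong_quantifier_rule _ = None"

definition strong_inferences :: "('f, 'p) ptree \<Rightarrow> (nat \<times> ('f, 'p) fm) set" where
  "strong_inferences \<pi> = {(a, P). \<exists>r\<in>rules \<pi>. strong_quantifier_rule r = Some (a, P)}"

text \<open>The relation \<open><\<^sub>\<pi>\<close> on variables. If the principal formula still contains the characteristic
  variable \<open>a\<close>, then \<open>a <\<^sub>\<pi> a\<close>.\<close>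

definition var_less :: "('f, 'p) ptree \<Rightarrow> (nat \<times> nat) set" where
  "var_less \<pi> = {(a, b). \<exists>P. (a, P) \<in> strong_inferences \<pi> \<and> b \<in> fv P}"

definition suitable :: "('f, 'p) ptree \<Rightarrow> ('f, 'p) rule \<Rightarrow> bool" where
  "suitable \<pi> r \<longleftrightarrow>
    weak_quantifier_rule r \<or>
    (\<exists>a P. strong_quantifier_rule r = Some (a, P) \<and> a \<notin> fv_seq (end_sequent \<pi>)) \<and>
    acyclic (var_less \<pi>) \<and>
    (\<forall>b P Q. (b, P) \<in> strong_inferences \<pi> \<longrightarrow> (b, Q) \<in> strong_inferences \<pi> \<longrightarrow> P = Q)"

definition quantifier_rule :: "('f, 'p) rule \<Rightarrow> bool" where
  "quantifier_rule r \<longleftrightarrow> weak_quantifier_rule r \<or> strong_quantifier_rule r \<noteq> None"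

definition LJpp_proof :: "('f, 'p) ptree \<Rightarrow> bool" where
  "LJpp_proof \<pi> \<longleftrightarrow> lj_tree \<pi> \<and> (\<forall>r\<in>rules \<pi>. quantifier_rule r \<longrightarrow> suitable \<pi> r)"

definition cut_free :: "('f, 'p) ptree \<Rightarrow> bool" where
  "cut_free \<pi> \<longleftrightarrow> Cut \<notin> rules \<pi>"

definition atomic_axioms :: "('f, 'p) ptree \<Rightarrow> bool" where
  "atomic_axioms \<pi> \<longleftrightarrow>
    (\<forall>S\<in>initial_sequents \<pi>. (\<exists>A. is_atom A \<and> S = ({#A#} \<turnstile> {#A#})) \<or> S = ({#Bot#} \<turnstile> {#}))"

text \<open>\<open>has_strong p A\<close>: \<open>A\<close> contains a strong quantifier, when \<open>A\<close> itself occurs positively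
  (\<open>p = True\<close>) or negatively (\<open>p = False\<close>).\<close>

primrec has_strong :: "bool \<Rightarrow> ('f, 'p) fm \<Rightarrow> bool" where
  "has_strong p Bot \<longleftrightarrow> False"
| "has_strong p (Pre q ts) \<longleftrightarrow> False"
| "has_strong p (And A B) \<longleftrightarrow> has_strong p A \<or> has_strong p B"
| "has_strong p (Or A B) \<longleftrightarrow> has_strong p A \<or> has_strong p B"
| "has_strong p (Imp A B) \<longleftrightarrow> has_strong (\<not> p) A \<or> has_strong p B"
| "has_strong p (All A) \<longleftrightarrow> p \<or> has_strong p A"
| "has_strong p (Ex A) \<longleftrightarrow> \<not> p \<or> has_strong p A"

text \<open>Deletes the first (leftmost) strong quantifier and substitutes the Skolem term for its
  variable. The argument \<open>n\<close> counts the quantifiers passed so far; none of them is strong, since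
  otherwise the search would have stopped there. Hence they are exactly the weak quantifiers
  dominating the deleted one, and their variables, outermost first, are the indices
  \<open>n - 1, \<dots>, 0\<close>.\<close>

primrec skolem_first :: "bool \<Rightarrow> nat \<Rightarrow> 'f \<Rightarrow> ('f, 'p) fm \<Rightarrow> ('f, 'p) fm" where
  "skolem_first p n f Bot = Bot"
| "skolem_first p n f (Pre q ts) = Pre q ts"
| "skolem_first p n f (And A B) =
    (if has_strong p A then And (skolem_first p n f A) B else And A (skolem_first p n f B))"
| "skolem_first p n f (Or A B) =
    (if has_strong p A then Or (skolem_first p n f A) B else Or A (skolem_first p n f B))"
| "skolem_first p n f (Imp A B) =
    (if has_strong (\<not> p) A then Imp (skolem_first (\<not> p) n f A) B
     else Imp A (skolem_first p n f B))"
| "skolem_first p n f (All A) =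
    (if p then inst 0 (Fun f (map Bound (rev [0..<n]))) A else All (skolem_first p (Suc n) f A))"
| "skolem_first p n f (Ex A) =
    (if \<not> p then inst 0 (Fun f (map Bound (rev [0..<n]))) A else Ex (skolem_first p (Suc n) f A))"

text \<open>Iteration until no strong quantifier is left; \<open>U\<close> collects the function symbols that are no
  longer fresh.\<close>

inductive skolem_iter :: "'f set \<Rightarrow> ('f, 'p) fm \<Rightarrow> ('f, 'p) fm \<Rightarrow> bool" where
  "\<not> has_strong True F \<Longrightarrow> skolem_iter U F F"
| "has_strong True F \<Longrightarrow> f \<notin> U \<Longrightarrow> skolem_iter (insert f U) (skolem_first True 0 f F) G \<Longrightarrow>
    skolem_iter U F G"

text \<open>\<open>G\<close> is a structural Skolemization \<open>F\<^sup>S\<close> of the closed formula \<open>F\<close>. It is a relation because the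
  choice of the fresh symbols is free.\<close>

definition skolemization :: "('f, 'p) fm \<Rightarrow> ('f, 'p) fm \<Rightarrow> bool" where
  "skolemization F G \<longleftrightarrow> closed_fm F \<and> skolem_iter (funs F) F G"

fun Conj :: "('f, 'p) fm list \<Rightarrow> ('f, 'p) fm" where
  "Conj [] = Imp Bot Bot"
| "Conj [A] = A"
| "Conj (A # B # As) = And A (Conj (B # As))"

fun Disj :: "('f, 'p) fm list \<Rightarrow> ('f, 'p) fm" where
  "Disj [] = Bot"
| "Disj [A] = A"
| "Disj (A # B # As) = Or A (Disj (B # As))"

text \<open>The lists enumerate the multisets. The conditions on their lengths make the decomposition of
  \<open>F\<^sup>S\<close> into conjuncts and disjuncts the one inherited from \<open>F\<close>.\<close>

definition seq_skolemization :: "('f, 'p) sequent \<Rightarrow> ('f, 'p) sequent \<Rightarrow> bool" where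
  "seq_skolemization S T \<longleftrightarrow>
    (\<exists>As Bs Cs Ds. S = (mset As \<turnstile> mset Bs) \<and> T = (mset Cs \<turnstile> mset Ds) \<and>
      length Cs = length As \<and> length Ds = length Bs \<and>
      skolemization (Imp (Conj As) (Disj Bs)) (Imp (Conj Cs) (Disj Ds)))"

end

theory Submission
  imports Defs "HOL-Library.Countable"
begin

text \<open>
  Skolem functions are eliminated one at a time, the last one introduced first. In a cut-free
  derivation whose end-sequent contains the Skolem function \<open>f\<close>, every term \<open>f(t\<^sub>1,\<dots>,t\<^sub>n)\<close> is
  replaced by a variable named after it, and where the instance \<open>A(f(t\<^sub>1,\<dots>,t\<^sub>n))\<close> is used, the
  deleted strong quantifier is reintroduced with that variable as characteristic variable. Without
  the eigenvariable condition no inference has to be moved. The variable determines the terms \<open>t\<^sub>i\<close>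
  and hence the principal formula. Acyclicity is seen by regarding every variable as the name of a
  term, the old variables being renamed to names of themselves: the name of \<open>f(t\<^sub>1,\<dots>,t\<^sub>n)\<close> depends
  only on names of smaller terms without additional variables, and the name of an old variable \<open>a\<close>
  only on names of terms whose variables come after \<open>a\<close> in \<open><\<^sub>\<pi>\<close>. Thus a cycle would either consist of
  ever smaller terms or yield a cycle of \<open><\<^sub>\<pi>\<close>.
\<close>

section \<open>Derivability from a set of strong inferences\<close>

lemmas lk_inference_cases = lk_inference.cases [consumes 1, case_names
    AxAtom AxBot WeakL WeakR ContrL ContrR AndL1 AndL2 AndR OrL OrR1 OrR2 ImpL ImpR
    AllL AllR ExL ExR Cut]

lemmas lk_AxAtom = lk_inference.intros(1)
  and lk_AxBot = lk_inference.intros(2)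
  and lk_AllL = lk_inference.intros(15)
  and lk_AllR = lk_inference.intros(16)
  and lk_ExL = lk_inference.intros(17)
  and lk_ExR = lk_inference.intros(18)

text \<open>Confining the terms to finitely many function symbols \<open>K\<close> makes it possible to name all of them
  by variables, which are natural numbers.\<close>

fun permitted :: "(nat \<times> ('f, 'p) fm) set \<Rightarrow> 'f set \<Rightarrow> ('f, 'p) rule \<Rightarrow> bool" where
  "permitted \<Sigma> K (AllL A t) \<longleftrightarrow> funs_tm t \<subseteq> K"
| "permitted \<Sigma> K (AllR A a) \<longleftrightarrow> (a, All A) \<in> \<Sigma>"
| "permitted \<Sigma> K (ExL A a) \<longleftrightarrow> (a, Ex A) \<in> \<Sigma>"
| "permitted \<Sigma> K (ExR A t) \<longleftrightarrow> funs_tm t \<subseteq> K"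
| "permitted \<Sigma> K Cut \<longleftrightarrow> False"
| "permitted \<Sigma> K _ \<longleftrightarrow> True"

definition lj_sequent :: "('f, 'p) sequent \<Rightarrow> bool" where
  "lj_sequent S \<longleftrightarrow> lc_seq S \<and> size (succedent S) \<le> 1"

inductive derivable_within ::
  "(nat \<times> ('f, 'p) fm) set \<Rightarrow> 'f set \<Rightarrow> ('f, 'p) sequent \<Rightarrow> bool" for \<Sigma> K where
  infer: "lk_inference r Ss S \<Longrightarrow> permitted \<Sigma> K r \<Longrightarrow> lj_sequent S \<Longrightarrow>
    (\<And>S'. S' \<in> set Ss \<Longrightarrow> derivable_within \<Sigma> K S') \<Longrightarrow> derivable_within \<Sigma> K S"

definition dependencies :: "(nat \<times> ('f, 'p) fm) set \<Rightarrow> (nat \<times> nat) set" where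
  "dependencies \<Sigma> = {(a, b). \<exists>P. (a, P) \<in> \<Sigma> \<and> b \<in> fv P}"

definition suitable_set :: "(nat \<times> ('f, 'p) fm) set \<Rightarrow> bool" where
  "suitable_set \<Sigma> \<longleftrightarrow> acyclic (dependencies \<Sigma>) \<and> single_valued \<Sigma>"

definition suitably_derivable :: "('f, 'p) sequent \<Rightarrow> bool" where
  "suitably_derivable S \<longleftrightarrow>
    (\<exists>\<Sigma> K. suitable_set \<Sigma> \<and> finite K \<and> (\<forall>(a, P)\<in>\<Sigma>. funs P \<subseteq> K) \<and> derivable_within \<Sigma> K S)"

lemma derivable_within_mono:
  assumes "derivable_within \<Sigma> K S" and "\<Sigma> \<subseteq> \<Sigma>'" and "K \<subseteq> K'"
  shows "derivable_within \<Sigma>' K' S"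
  using assms(1)
proof (induction rule: derivable_within.induct)
  case (infer r Ss S)
  have "permitted \<Sigma>' K' r"
    using \<open>permitted \<Sigma> K r\<close> assms(2,3) by (cases r) auto
  then show ?case
    using infer by (intro derivable_within.infer[of r Ss S]) simp_all
qed

lemma derivable_within_of_tree:
  assumes "lj_tree \<pi>" and "\<forall>r\<in>rules \<pi>. permitted \<Sigma> K r"
  shows "derivable_within \<Sigma> K (end_sequent \<pi>)"
  using assms
proof (induction \<pi>)
  case (Infer r \<pi>s S)
  have "derivable_within \<Sigma> K (end_sequent \<rho>)" if "\<rho> \<in> set \<pi>s" for \<rho>
    using Infer.IH[OF that] Infer.prems that by (simp add: list_all_iff)
  then show ?case
    by (intro derivable_within.infer[of r "map end_sequent \<pi>s" "end_sequent (Infer r \<pi>s S)"])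
      (use Infer.prems in \<open>auto simp: lj_sequent_def\<close>)
qed

lemma tree_of_derivable_within:
  assumes "derivable_within \<Sigma> K S"
  shows "\<exists>\<pi>. lj_tree \<pi> \<and> end_sequent \<pi> = S \<and> (\<forall>r\<in>rules \<pi>. permitted \<Sigma> K r)"
  using assms
proof (induction rule: derivable_within.induct)
  case (infer r Ss S)
  then obtain \<tau> where \<tau>: "\<And>S'. S' \<in> set Ss \<Longrightarrow>
      lj_tree (\<tau> S') \<and> end_sequent (\<tau> S') = S' \<and> (\<forall>r\<in>rules (\<tau> S'). permitted \<Sigma> K r)"
    by metis
  then have "map end_sequent (map \<tau> Ss) = Ss"
    by (simp add: map_idI)
  then have "lj_tree (Infer r (map \<tau> Ss) S)"
    using infer.hyps \<tau> by (simp add: lj_sequent_def list_all_iff)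
  moreover have "\<forall>r\<in>rules (Infer r (map \<tau> Ss) S). permitted \<Sigma> K r"
    using infer.hyps \<tau> by auto
  ultimately show ?case
    by (intro exI[of _ "Infer r (map \<tau> Ss) S"]) simp
qed

lemma finite_funs_tm: "finite (funs_tm t)"
  by (induction t) auto

lemma finite_funs: "finite (funs A)"
  by (induction A) (auto simp: finite_funs_tm)

lemma finite_rules: "finite (rules \<pi>)"
  by (induction \<pi>) auto

fun funs_rule :: "('f, 'p) rule \<Rightarrow> 'f set" where
  "funs_rule (AllL A t) = funs_tm t"
| "funs_rule (AllR A a) = funs A"
| "funs_rule (ExL A a) = funs A"
| "funs_rule (ExR A t) = funs_tm t"
| "funs_rule _ = {}"

lemma finite_funs_rule: "finite (funs_rule r)"
  by (cases r) (auto simp: finite_funs finite_funs_tm)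

lemma funs_strong_inferences:
  "(a, P) \<in> strong_inferences \<pi> \<Longrightarrow> funs P \<subseteq> \<Union>(funs_rule ` rules \<pi>)"
proof -
  assume "(a, P) \<in> strong_inferences \<pi>"
  then obtain r where r: "r \<in> rules \<pi>" "strong_quantifier_rule r = Some (a, P)"
    by (auto simp: strong_inferences_def)
  then have "funs P = funs_rule r"
    by (cases r) auto
  then show ?thesis
    using r(1) by blast
qed

lemma var_less_eq_dependencies: "var_less \<pi> = dependencies (strong_inferences \<pi>)"
  by (simp add: var_less_def dependencies_def)

lemma suitable_set_strong_inferences:
  assumes "LJpp_proof \<pi>"
  shows "suitable_set (strong_inferences \<pi>)"
proof (cases "strong_inferences \<pi> = {}")
  case True
  then show ?thesis
    by (simp add: suitable_set_def dependencies_def acyclic_def)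
next
  case False
  then obtain r a P where r: "r \<in> rules \<pi>" "strong_quantifier_rule r = Some (a, P)"
    by (auto simp: strong_inferences_def)
  then have "suitable \<pi> r"
    using assms by (auto simp: LJpp_proof_def quantifier_rule_def)
  moreover have "\<not> weak_quantifier_rule r"
    using r(2) by (cases r) auto
  ultimately show ?thesis
    by (auto simp: suitable_def suitable_set_def single_valued_def var_less_eq_dependencies)
qed

lemma suitably_derivable_of_proof:
  assumes "LJpp_proof \<pi>" and "cut_free \<pi>"
  shows "suitably_derivable (end_sequent \<pi>)"
proof -
  let ?\<Sigma> = "strong_inferences \<pi>" and ?K = "\<Union>(funs_rule ` rules \<pi>)"
  have "permitted ?\<Sigma> ?K r" if "r \<in> rules \<pi>" for r
    using that assms(2) by (cases r) (force simp: strong_inferences_def cut_free_def)+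
  then have "derivable_within ?\<Sigma> ?K (end_sequent \<pi>)"
    using assms(1) by (simp add: LJpp_proof_def derivable_within_of_tree)
  moreover have "finite ?K"
    by (simp add: finite_rules finite_funs_rule)
  moreover have "\<forall>(a, P)\<in>?\<Sigma>. funs P \<subseteq> ?K"
    using funs_strong_inferences by fast
  ultimately show ?thesis
    using suitable_set_strong_inferences[OF assms(1)] unfolding suitably_derivable_def
    by (intro exI[of _ ?\<Sigma>] exI[of _ ?K]) simp
qed

lemma proof_of_suitably_derivable:
  assumes "suitably_derivable S" and "fv_seq S = {}"
  shows "\<exists>\<pi>. LJpp_proof \<pi> \<and> end_sequent \<pi> = S \<and> cut_free \<pi>"
proof -
  obtain \<Sigma> K where \<Sigma>: "suitable_set \<Sigma>" "derivable_within \<Sigma> K S"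
    using assms(1) by (auto simp: suitably_derivable_def)
  then obtain \<pi> where \<pi>: "lj_tree \<pi>" "end_sequent \<pi> = S" "\<forall>r\<in>rules \<pi>. permitted \<Sigma> K r"
    using tree_of_derivable_within by blast
  have "permitted \<Sigma> K r \<Longrightarrow> strong_quantifier_rule r = Some (a, P) \<Longrightarrow> (a, P) \<in> \<Sigma>" for r a P
    by (cases r) auto
  then have "strong_inferences \<pi> \<subseteq> \<Sigma>"
    using \<pi>(3) by (auto simp: strong_inferences_def)
  then have "single_valued (strong_inferences \<pi>)" and deps: "var_less \<pi> \<subseteq> dependencies \<Sigma>"
    using \<Sigma>(1) single_valued_subset[of "strong_inferences \<pi>" \<Sigma>]
    by (simp_all add: suitable_set_def) (auto simp: var_less_eq_dependencies dependencies_def)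
  moreover have "acyclic (var_less \<pi>)"
    using \<Sigma>(1) acyclic_subset[OF _ deps] by (simp add: suitable_set_def)
  ultimately have "suitable \<pi> r" if "quantifier_rule r" for r
    using that assms(2) \<pi>(2) by (auto simp: suitable_def quantifier_rule_def single_valued_def)
  then have "LJpp_proof \<pi>"
    using \<pi>(1) by (simp add: LJpp_proof_def)
  moreover have "cut_free \<pi>"
    using \<pi>(3) by (auto simp: cut_free_def)
  ultimately show ?thesis
    using \<pi>(2) by blast
qed

section \<open>Instantiation\<close>

lemma shift_tm_closed: "lc_tm 0 t \<Longrightarrow> shift_tm k t = t"
  by (induction t) (auto simp: list_all_iff map_idI)

lemma inst_tm_closed: "lc_tm 0 s \<Longrightarrow> inst_tm k t s = s"
  by (induction s) (auto simp: list_all_iff map_idI)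

lemma lc_tm_mono: "lc_tm k t \<Longrightarrow> k \<le> l \<Longrightarrow> lc_tm l t"
  by (induction t) (auto simp: list_all_iff)

lemma lc_tm_inst_tm:
  assumes "lc_tm 0 t" and "k \<le> l"
  shows "lc_tm l (inst_tm k t s) \<longleftrightarrow> lc_tm (Suc l) s"
proof (induction s)
  case (Bound i)
  then show ?case
    using assms lc_tm_mono[of 0 t l] by (auto simp: shift_tm_closed)
qed (auto simp: list_all_iff)

lemma lc_inst: "lc_tm 0 t \<Longrightarrow> k \<le> l \<Longrightarrow> lc l (inst k t A) \<longleftrightarrow> lc (Suc l) A"
  by (induction A arbitrary: k l) (auto simp: list_all_iff lc_tm_inst_tm)

lemma fv_shift_tm: "fv_tm (shift_tm k t) = fv_tm t"
  by (induction t) auto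

lemma fv_inst_tm: "fv_tm (inst_tm k t s) \<subseteq> fv_tm s \<union> fv_tm t"
  by (induction s) (auto simp: fv_shift_tm)

lemma fv_inst: "fv (inst k t A) \<subseteq> fv A \<union> fv_tm t"
proof (induction A arbitrary: k)
  case (Pre p ts)
  then show ?case using fv_inst_tm[of k t] by fastforce
qed (simp; blast)+

lemma funs_shift_tm: "funs_tm (shift_tm k t) = funs_tm t"
  by (induction t) auto

lemma funs_inst_tm: "funs_tm (inst_tm k t s) \<subseteq> funs_tm s \<union> funs_tm t"
  by (induction s) (auto simp: funs_shift_tm)

lemma funs_inst: "funs (inst k t A) \<subseteq> funs A \<union> funs_tm t"
proof (induction A arbitrary: k)
  case (Pre p ts)
  then show ?case using funs_inst_tm[of k t] by fastforce
qed (simp; blast)+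

lemma inst_tm_shift_tm: "lc_tm 0 t \<Longrightarrow> inst_tm k t (shift_tm k s) = shift_tm k (inst_tm 0 t s)"
  by (induction s) (auto simp: shift_tm_closed)

lemma inst_tm_inst_tm:
  assumes "lc_tm 0 t"
  shows "inst_tm k t (inst_tm k s u) = inst_tm k (inst_tm 0 t s) (inst_tm (Suc k) t u)"
  by (induction u)
    (use assms in \<open>auto simp: shift_tm_closed inst_tm_closed inst_tm_shift_tm\<close>)

lemma inst_inst:
  "lc_tm 0 t \<Longrightarrow> inst k t (inst k s A) = inst k (inst_tm 0 t s) (inst (Suc k) t A)"
  by (induction A arbitrary: k) (auto simp: inst_tm_inst_tm)

text \<open>The first term replaces the innermost index.\<close>

abbreviation insts_tm :: "nat \<Rightarrow> 'f tm list \<Rightarrow> 'f tm \<Rightarrow> 'f tm" where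
  "insts_tm k ts \<equiv> fold (inst_tm k) ts"

abbreviation insts :: "nat \<Rightarrow> 'f tm list \<Rightarrow> ('f, 'p) fm \<Rightarrow> ('f, 'p) fm" where
  "insts k ts \<equiv> fold (inst k) ts"

lemma insts_simps [simp]:
  "insts k ts (And A B) = And (insts k ts A) (insts k ts B)"
  "insts k ts (Or A B) = Or (insts k ts A) (insts k ts B)"
  "insts k ts (Imp A B) = Imp (insts k ts A) (insts k ts B)"
  "insts k ts (All A) = All (insts (Suc k) ts A)"
  "insts k ts (Ex A) = Ex (insts (Suc k) ts A)"
  by (induction ts arbitrary: A B) auto

lemma fv_insts: "fv (insts k ts A) \<subseteq> fv A \<union> \<Union>(fv_tm ` set ts)"
proof (induction ts arbitrary: A)
  case (Cons t ts)
  show ?case using Cons[of "inst k t A"] fv_inst[of k t A] by auto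
qed simp

lemma funs_insts: "funs (insts k ts A) \<subseteq> funs A \<union> \<Union>(funs_tm ` set ts)"
proof (induction ts arbitrary: A)
  case (Cons t ts)
  show ?case using Cons[of "inst k t A"] funs_inst[of k t A] by auto
qed simp

lemma inst_insts:
  "lc_tm 0 t \<Longrightarrow> list_all (lc_tm 0) ts \<Longrightarrow> inst k t (insts (Suc k) ts A) = insts k (t # ts) A"
  by (induction ts arbitrary: A) (simp_all add: inst_inst inst_tm_closed)

lemma insts_inst:
  "list_all (lc_tm 0) ts \<Longrightarrow>
    insts k ts (inst k s A) = inst k (insts_tm 0 ts s) (insts (Suc k) ts A)"
  by (induction ts arbitrary: s A) (simp_all add: inst_inst)

abbreviation skolem_tm :: "nat \<Rightarrow> 'f \<Rightarrow> 'f tm" where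
  "skolem_tm n f \<equiv> Fun f (map Bound (rev [0..<n]))"

lemma insts_tm_closed: "lc_tm 0 t \<Longrightarrow> insts_tm k ts t = t"
  by (induction ts) (simp_all add: inst_tm_closed)

lemma insts_tm_Fun: "insts_tm k ts (Fun h us) = Fun h (map (insts_tm k ts) us)"
  by (induction ts arbitrary: us) simp_all

lemma insts_tm_Bound:
  "list_all (lc_tm 0) ts \<Longrightarrow> i < length ts \<Longrightarrow> insts_tm 0 ts (Bound i) = ts ! i"
  by (induction ts arbitrary: i) (auto simp: shift_tm_closed insts_tm_closed nth_Cons')

lemma insts_tm_skolem_tm:
  assumes "list_all (lc_tm 0) ts"
  shows "insts_tm 0 ts (skolem_tm (length ts) f) = Fun f (rev ts)"
proof -
  have "map (insts_tm 0 ts) (map Bound [0..<length ts]) = ts"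
    using assms by (intro nth_equalityI) (simp_all add: insts_tm_Bound)
  then show ?thesis
    by (simp only: insts_tm_Fun flip: rev_map)
qed

lemma insts_skolem_instance:
  assumes "list_all (lc_tm 0) ts"
  shows "insts 0 ts (inst 0 (skolem_tm (length ts) f) A) = insts 0 (Fun f (rev ts) # ts) A"
  using assms by (simp only: insts_inst insts_tm_skolem_tm) (simp add: inst_insts)

lemma fv_skolem_first: "fv (skolem_first p n f A) \<subseteq> fv A"
proof (induction A arbitrary: p n)
  case (All A)
  then show ?case using fv_inst[of 0 "skolem_tm n f" A] by auto
next
  case (Ex A)
  then show ?case using fv_inst[of 0 "skolem_tm n f" A] by auto
qed (simp; blast)+

lemma funs_skolem_first: "funs (skolem_first p n f A) \<subseteq> insert f (funs A)"
proof (induction A arbitrary: p n)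
  case (All A)
  then show ?case using funs_inst[of 0 "skolem_tm n f" A] by auto
next
  case (Ex A)
  then show ?case using funs_inst[of 0 "skolem_tm n f" A] by auto
qed (simp; blast)+

section \<open>Variables as names of terms\<close>

text \<open>Dangling indices inside a Skolem term are lost; therefore the translation commutes with
  instantiation only on formulas whose Skolem terms are closed.\<close>

primrec deskolem_tm :: "('f tm \<Rightarrow> nat) \<Rightarrow> 'f \<Rightarrow> 'f tm \<Rightarrow> 'f tm" where
  "deskolem_tm \<nu> f (Free a) = Free (\<nu> (Free a))"
| "deskolem_tm \<nu> f (Bound i) = Bound i"
| "deskolem_tm \<nu> f (Fun h ts) =
    (if h = f then Free (\<nu> (Fun h ts)) else Fun h (map (deskolem_tm \<nu> f) ts))"

primrec deskolem :: "('f tm \<Rightarrow> nat) \<Rightarrow> 'f \<Rightarrow> ('f, 'p) fm \<Rightarrow> ('f, 'p) fm" where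
  "deskolem \<nu> f Bot = Bot"
| "deskolem \<nu> f (Pre p ts) = Pre p (map (deskolem_tm \<nu> f) ts)"
| "deskolem \<nu> f (And A B) = And (deskolem \<nu> f A) (deskolem \<nu> f B)"
| "deskolem \<nu> f (Or A B) = Or (deskolem \<nu> f A) (deskolem \<nu> f B)"
| "deskolem \<nu> f (Imp A B) = Imp (deskolem \<nu> f A) (deskolem \<nu> f B)"
| "deskolem \<nu> f (All A) = All (deskolem \<nu> f A)"
| "deskolem \<nu> f (Ex A) = Ex (deskolem \<nu> f A)"

primrec skolem_closed_tm :: "'f \<Rightarrow> 'f tm \<Rightarrow> bool" where
  "skolem_closed_tm f (Free a) \<longleftrightarrow> True"
| "skolem_closed_tm f (Bound i) \<longleftrightarrow> True"
| "skolem_closed_tm f (Fun h ts) \<longleftrightarrow>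
    (if h = f then list_all (lc_tm 0) ts else list_all (skolem_closed_tm f) ts)"

primrec skolem_closed :: "'f \<Rightarrow> ('f, 'p) fm \<Rightarrow> bool" where
  "skolem_closed f Bot \<longleftrightarrow> True"
| "skolem_closed f (Pre p ts) \<longleftrightarrow> list_all (skolem_closed_tm f) ts"
| "skolem_closed f (And A B) \<longleftrightarrow> skolem_closed f A \<and> skolem_closed f B"
| "skolem_closed f (Or A B) \<longleftrightarrow> skolem_closed f A \<and> skolem_closed f B"
| "skolem_closed f (Imp A B) \<longleftrightarrow> skolem_closed f A \<and> skolem_closed f B"
| "skolem_closed f (All A) \<longleftrightarrow> skolem_closed f A"
| "skolem_closed f (Ex A) \<longleftrightarrow> skolem_closed f A"

lemma lc_deskolem_tm: "lc_tm k t \<Longrightarrow> lc_tm k (deskolem_tm \<nu> f t)"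
  by (induction t) (auto simp: list_all_iff)

lemma lc_deskolem: "lc k A \<Longrightarrow> lc k (deskolem \<nu> f A)"
  by (induction A arbitrary: k) (auto simp: list_all_iff lc_deskolem_tm)

lemma funs_deskolem_tm: "funs_tm (deskolem_tm \<nu> f t) \<subseteq> funs_tm t"
  by (induction t) auto

lemma funs_deskolem: "funs (deskolem \<nu> f A) \<subseteq> funs A"
  using funs_deskolem_tm by (induction A) fastforce+

lemma fv_deskolem_tm:
  assumes "b \<in> fv_tm (deskolem_tm \<nu> f t)"
  shows "\<exists>s. b = \<nu> s \<and> fv_tm s \<subseteq> fv_tm t \<and> funs_tm s \<subseteq> funs_tm t \<and> size s \<le> size t"
  using assms
proof (induction t)
  case (Fun h ts)
  show ?case
  proof (cases "h = f")
    case True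
    then show ?thesis
      using Fun.prems by (intro exI[of _ "Fun h ts"]) simp
  next
    case False
    then obtain u where u: "u \<in> set ts" "b \<in> fv_tm (deskolem_tm \<nu> f u)"
      using Fun.prems by auto
    moreover have "size u \<le> size (Fun h ts)"
      using size_list_estimation'[OF u(1) order_refl, of size] by simp
    ultimately show ?thesis
      using Fun.IH[OF u] by fastforce
  qed
qed auto

lemma fv_deskolem:
  assumes "b \<in> fv (deskolem \<nu> f A)"
  shows "\<exists>s. b = \<nu> s \<and> fv_tm s \<subseteq> fv A \<and> funs_tm s \<subseteq> funs A"
  using assms
proof (induction A)
  case (Pre p ts)
  then obtain t where "t \<in> set ts" "b \<in> fv_tm (deskolem_tm \<nu> f t)"
    by auto
  then show ?case
    using fv_deskolem_tm by fastforce
qed (simp; blast)+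

lemma deskolem_tm_id: "fv_tm t = {} \<Longrightarrow> f \<notin> funs_tm t \<Longrightarrow> deskolem_tm \<nu> f t = t"
  by (induction t) (auto simp: map_idI)

lemma deskolem_id: "fv A = {} \<Longrightarrow> f \<notin> funs A \<Longrightarrow> deskolem \<nu> f A = A"
  by (induction A) (auto simp: map_idI deskolem_tm_id)

lemma skolem_closed_tm_fresh: "f \<notin> funs_tm t \<Longrightarrow> skolem_closed_tm f t"
  by (induction t) (auto simp: list_all_iff)

lemma skolem_closed_fresh: "f \<notin> funs A \<Longrightarrow> skolem_closed f A"
  by (induction A) (auto simp: list_all_iff skolem_closed_tm_fresh)

lemma skolem_closed_tm_closed: "lc_tm 0 t \<Longrightarrow> skolem_closed_tm f t"
  by (induction t) (auto simp: list_all_iff)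

lemma skolem_closed_inst_tm:
  "skolem_closed_tm f s \<Longrightarrow> lc_tm 0 t \<Longrightarrow> skolem_closed_tm f (inst_tm k t s)"
  by (induction s)
    (auto simp: list_all_iff inst_tm_closed shift_tm_closed skolem_closed_tm_closed)

lemma skolem_closed_inst:
  "skolem_closed f A \<Longrightarrow> lc_tm 0 t \<Longrightarrow> skolem_closed f (inst k t A)"
  by (induction A arbitrary: k) (auto simp: list_all_iff skolem_closed_inst_tm)

lemma skolem_closed_insts:
  "skolem_closed f A \<Longrightarrow> list_all (lc_tm 0) ts \<Longrightarrow> skolem_closed f (insts k ts A)"
  by (induction ts arbitrary: A) (simp_all add: skolem_closed_inst)

lemma deskolem_inst_tm:
  "skolem_closed_tm f s \<Longrightarrow> lc_tm 0 t \<Longrightarrow>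
    deskolem_tm \<nu> f (inst_tm k t s) = inst_tm k (deskolem_tm \<nu> f t) (deskolem_tm \<nu> f s)"
  by (induction s)
    (auto simp: list_all_iff inst_tm_closed shift_tm_closed lc_deskolem_tm map_idI)

lemma deskolem_inst:
  "skolem_closed f A \<Longrightarrow> lc_tm 0 t \<Longrightarrow>
    deskolem \<nu> f (inst k t A) = inst k (deskolem_tm \<nu> f t) (deskolem \<nu> f A)"
  by (induction A arbitrary: k) (auto simp: list_all_iff deskolem_inst_tm)

lemma deskolem_insts:
  "skolem_closed f A \<Longrightarrow> list_all (lc_tm 0) ts \<Longrightarrow>
    deskolem \<nu> f (insts k ts A) = insts k (map (deskolem_tm \<nu> f) ts) (deskolem \<nu> f A)"
  by (induction ts arbitrary: A) (simp_all add: deskolem_inst skolem_closed_inst)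

instance tm :: (countable) countable
  by countable_datatype

lemma funs_tm_eq_set_tm: "funs_tm t = set_tm t"
  by (induction t) auto

lemma ex_term_naming:
  fixes K :: "'f set"
  assumes "finite K"
  shows "\<exists>\<nu> :: 'f tm \<Rightarrow> nat. inj_on \<nu> {t. funs_tm t \<subseteq> K}"
proof -
  obtain g :: "'f \<Rightarrow> nat" where g: "inj_on g K"
    using finite_imp_inj_to_nat_seg[OF assms] by auto
  have "inj_on (map_tm g) {t. funs_tm t \<subseteq> K}"
  proof (rule inj_onI)
    fix s t
    assume "s \<in> {t. funs_tm t \<subseteq> K}" "t \<in> {t. funs_tm t \<subseteq> K}" "map_tm g s = map_tm g t"
    then show "s = t"
      by (intro tm.inj_map_strong[of s t g g] inj_onD[OF g]) (auto simp: funs_tm_eq_set_tm)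
  qed
  then have "inj_on (to_nat \<circ> map_tm g) {t. funs_tm t \<subseteq> K}"
    by (simp add: comp_inj_on)
  then show ?thesis
    by blast
qed

definition term_dependency :: "(nat \<times> nat) set \<Rightarrow> ('f tm \<times> 'f tm) set" where
  "term_dependency D = {(s, t). size t < size s \<and> fv_tm t \<subseteq> fv_tm s \<or>
    fv_tm s \<noteq> {} \<and> fv_tm t \<subseteq> D `` fv_tm s}"

lemma trans_term_dependency:
  assumes "trans D"
  shows "trans (term_dependency D)"
proof (rule transI)
  fix s t u
  assume st: "(s, t) \<in> term_dependency D" and tu: "(t, u) \<in> term_dependency D"
  have "D `` (D `` A) \<subseteq> D `` A" for A
    using assms by (auto dest: transD)
  then have "D `` fv_tm t \<subseteq> D `` fv_tm s" and "fv_tm t \<noteq> {} \<Longrightarrow> fv_tm s \<noteq> {}"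
    using st unfolding term_dependency_def by blast+
  then show "(s, u) \<in> term_dependency D"
    using st tu unfolding term_dependency_def
    by simp (meson order.trans order.strict_trans)
qed

lemma finite_fv_tm: "finite (fv_tm t)"
  by (induction t) auto

lemma acyclic_not_subset_Image:
  assumes "acyclic D" and "finite A" and "A \<noteq> {}"
  shows "\<not> A \<subseteq> D `` A"
proof
  assume "A \<subseteq> D `` A"
  have "acyclic (D \<inter> A \<times> A)"
    using assms(1) by (rule acyclic_subset) simp
  then have "wf (D \<inter> A \<times> A)"
    using assms(2) by (intro finite_acyclic_wf) simp_all
  then obtain b where "b \<in> A" "\<forall>a. (a, b) \<in> D \<inter> A \<times> A \<longrightarrow> a \<notin> A"
    using assms(3) unfolding wf_eq_minimal by blast
  then show False
    using \<open>A \<subseteq> D `` A\<close> by blast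
qed

lemma acyclic_inv_image:
  assumes "acyclic r"
  shows "acyclic (inv_image r g)"
proof -
  have "(inv_image r g)\<^sup>+ \<subseteq> (inv_image (r\<^sup>+) g)\<^sup>+"
    by (intro trancl_mono_subset) auto
  also have "\<dots> = inv_image (r\<^sup>+) g"
    by (simp add: trans_inv_image)
  finally show ?thesis
    using assms by (auto simp: acyclic_def)
qed

lemma acyclic_term_dependency:
  assumes "trans D" and "acyclic D"
  shows "acyclic (term_dependency D :: ('f tm \<times> 'f tm) set)"
proof -
  have "trans (term_dependency D :: ('f tm \<times> 'f tm) set)"
    using assms(1) by (rule trans_term_dependency)
  moreover have "(s, s) \<notin> term_dependency D" for s :: "'f tm"
    using acyclic_not_subset_Image[OF assms(2) finite_fv_tm] by (auto simp: term_dependency_def)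
  ultimately show ?thesis
    by (simp add: acyclic_def)
qed

section \<open>Relating sequents formula by formula\<close>

lemma rel_mset_add_mset_iff:
  "rel_mset R (add_mset x M) N \<longleftrightarrow> (\<exists>y N'. N = add_mset y N' \<and> R x y \<and> rel_mset R M N')"
  using msed_rel_invL[of R x M N] by (auto intro: rel_mset_Plus)

lemma rel_mset_plus_iff:
  "rel_mset R (M + M') N \<longleftrightarrow> (\<exists>N\<^sub>1 N\<^sub>2. N = N\<^sub>1 + N\<^sub>2 \<and> rel_mset R M N\<^sub>1 \<and> rel_mset R M' N\<^sub>2)"
proof (induction M arbitrary: N)
  case (add x M)
  show ?case
    unfolding union_mset_add_mset_left rel_mset_add_mset_iff add.IH
    by (metis union_mset_add_mset_left)
qed simp

lemma rel_mset_replace: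
  assumes "rel_mset R M N"
    and "\<And>x y N. R x y \<Longrightarrow> (\<And>z. R' x z \<Longrightarrow> P (add_mset z N)) \<Longrightarrow> P (add_mset y N)"
    and "\<And>N. rel_mset R' M N \<Longrightarrow> P N"
  shows "P N"
  using assms
proof (induction M arbitrary: N P)
  case (add x M)
  from add.prems(1) obtain y N' where N: "N = add_mset y N'" "R x y" "rel_mset R M N'"
    by (auto simp: rel_mset_add_mset_iff)
  have "P (add_mset z N')" if "R' x z" for z
  proof (rule add.IH[OF N(3)])
    show "P (add_mset z (add_mset v M'))"
      if "R u v" "\<And>w. R' u w \<Longrightarrow> P (add_mset z (add_mset w M'))" for u v M'
      using add.prems(2)[OF that(1), of "add_mset z M'"] that(2) by (simp add: add_mset_commute)
    show "P (add_mset z M')" if "rel_mset R' M M'" for M'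
      using add.prems(3) rel_mset_Plus[of R', OF \<open>R' x z\<close> that] by blast
  qed
  then show ?case
    using add.prems(2) N(1,2) by blast
qed simp

fun rel_seq ::
  "(bool \<Rightarrow> ('f, 'p) fm \<Rightarrow> ('f, 'p) fm \<Rightarrow> bool) \<Rightarrow> ('f, 'p) sequent \<Rightarrow> ('f, 'p) sequent \<Rightarrow> bool" where
  "rel_seq R (\<Gamma> \<turnstile> \<Delta>) (\<Gamma>' \<turnstile> \<Delta>') \<longleftrightarrow> rel_mset (R False) \<Gamma> \<Gamma>' \<and> rel_mset (R True) \<Delta> \<Delta>'"

lemma rel_seq_left:
  "R False A B \<Longrightarrow> rel_seq R (\<Gamma> \<turnstile> \<Delta>) (\<Gamma>' \<turnstile> \<Delta>') \<Longrightarrow>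
    rel_seq R (add_mset A \<Gamma> \<turnstile> \<Delta>) (add_mset B \<Gamma>' \<turnstile> \<Delta>')"
  by (simp add: rel_mset_Plus)

lemma rel_seq_right:
  "R True A B \<Longrightarrow> rel_seq R (\<Gamma> \<turnstile> \<Delta>) (\<Gamma>' \<turnstile> \<Delta>') \<Longrightarrow>
    rel_seq R (\<Gamma> \<turnstile> add_mset A \<Delta>) (\<Gamma>' \<turnstile> add_mset B \<Delta>')"
  by (simp add: rel_mset_Plus)

lemma rel_seq_leftE:
  assumes "rel_seq R (add_mset A \<Gamma> \<turnstile> \<Delta>) S'"
  obtains B \<Gamma>' \<Delta>' where "S' = (add_mset B \<Gamma>' \<turnstile> \<Delta>')" "R False A B"
    "rel_seq R (\<Gamma> \<turnstile> \<Delta>) (\<Gamma>' \<turnstile> \<Delta>')"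
  using assms by (cases S') (auto simp: rel_mset_add_mset_iff)

lemma rel_seq_rightE:
  assumes "rel_seq R (\<Gamma> \<turnstile> add_mset A \<Delta>) S'"
  obtains B \<Gamma>' \<Delta>' where "S' = (\<Gamma>' \<turnstile> add_mset B \<Delta>')" "R True A B"
    "rel_seq R (\<Gamma> \<turnstile> \<Delta>) (\<Gamma>' \<turnstile> \<Delta>')"
  using assms by (cases S') (auto simp: rel_mset_add_mset_iff)

lemma rel_seq_plusE:
  assumes "rel_seq R (\<Gamma> + \<Pi> \<turnstile> \<Delta> + \<Lambda>) S'"
  obtains \<Gamma>' \<Pi>' \<Delta>' \<Lambda>' where "S' = (\<Gamma>' + \<Pi>' \<turnstile> \<Delta>' + \<Lambda>')"
    "rel_seq R (\<Gamma> \<turnstile> \<Delta>) (\<Gamma>' \<turnstile> \<Delta>')" "rel_seq R (\<Pi> \<turnstile> \<Lambda>) (\<Pi>' \<turnstile> \<Lambda>')"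
  using assms by (cases S') (auto simp: rel_mset_plus_iff)

lemma rel_seq_mono:
  assumes "rel_seq R S S'" and "\<And>p A B. R p A B \<Longrightarrow> R' p A B"
  shows "rel_seq R' S S'"
  using assms by (cases S; cases S') (auto elim: multiset.rel_mono_strong)

lemma rel_seq_empty [simp]:
  "rel_seq R ({#} \<turnstile> {#}) (\<Gamma>' \<turnstile> \<Delta>') \<longleftrightarrow> \<Gamma>' = {#} \<and> \<Delta>' = {#}"
  by simp

declare rel_seq.simps [simp del]

lemmas rel_seq_intros = rel_seq_left rel_seq_right

lemmas rel_seq_elims =
  rel_seq_leftE rel_seq_rightE rel_seq_plusE

lemma derivable_AllR:
  assumes "derivable_within \<Sigma> K (\<Gamma> \<turnstile> add_mset (inst 0 (Free a) A) \<Delta>)" and "(a, All A) \<in> \<Sigma>"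
  shows "derivable_within \<Sigma> K (\<Gamma> \<turnstile> add_mset (All A) \<Delta>)"
proof (rule derivable_within.infer[OF lk_AllR])
  have "lj_sequent (\<Gamma> \<turnstile> add_mset (inst 0 (Free a) A) \<Delta>)"
    using assms(1) by (cases rule: derivable_within.cases)
  then show "lj_sequent (\<Gamma> \<turnstile> add_mset (All A) \<Delta>)"
    by (auto simp: lj_sequent_def lc_inst)
qed (use assms in auto)

lemma derivable_ExL:
  assumes "derivable_within \<Sigma> K (add_mset (inst 0 (Free a) A) \<Gamma> \<turnstile> \<Delta>)" and "(a, Ex A) \<in> \<Sigma>"
  shows "derivable_within \<Sigma> K (add_mset (Ex A) \<Gamma> \<turnstile> \<Delta>)"
proof (rule derivable_within.infer[OF lk_ExL])
  have "lj_sequent (add_mset (inst 0 (Free a) A) \<Gamma> \<turnstile> \<Delta>)"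
    using assms(1) by (cases rule: derivable_within.cases)
  then show "lj_sequent (add_mset (Ex A) \<Gamma> \<turnstile> \<Delta>)"
    by (auto simp: lj_sequent_def lc_inst)
qed (use assms in auto)

section \<open>Reintroduction of the deleted quantifier\<close>

primrec first_strong :: "bool \<Rightarrow> ('f, 'p) fm \<Rightarrow> ('f, 'p) fm" where
  "first_strong p Bot = Bot"
| "first_strong p (Pre q ts) = Pre q ts"
| "first_strong p (And A B) = (if has_strong p A then first_strong p A else first_strong p B)"
| "first_strong p (Or A B) = (if has_strong p A then first_strong p A else first_strong p B)"
| "first_strong p (Imp A B) =
    (if has_strong (\<not> p) A then first_strong (\<not> p) A else first_strong p B)"
| "first_strong p (All A) = (if p then All A else first_strong p A)"
| "first_strong p (Ex A) = (if \<not> p then Ex A else first_strong p A)"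

lemma fv_first_strong: "fv (first_strong p A) \<subseteq> fv A"
  by (induction A arbitrary: p) auto

locale skolem_elimination =
  fixes \<nu> :: "'f tm \<Rightarrow> nat" and f :: 'f and K :: "'f set" and Q :: "('f, 'p) fm"
    and \<Sigma> :: "(nat \<times> ('f, 'p) fm) set"
  assumes inj_\<nu>: "inj_on \<nu> {t. funs_tm t \<subseteq> K}"
    and f_in_K: "f \<in> K"
    and funs_Q: "funs Q \<subseteq> K" and fv_Q: "fv Q = {}"
    and funs_\<Sigma>: "\<And>a P. (a, P) \<in> \<Sigma> \<Longrightarrow> funs P \<subseteq> K"
    and suitable_\<Sigma>: "suitable_set \<Sigma>"
begin

inductive_set restored_strong :: "(nat \<times> ('f, 'p) fm) set" where
  renamed: "(a, P) \<in> \<Sigma> \<Longrightarrow> (\<nu> (Free a), deskolem \<nu> f P) \<in> restored_strong"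
| reintroduced: "\<forall>t\<in>set ts. funs_tm t \<subseteq> K \<Longrightarrow>
    (\<nu> (Fun f (rev ts)), insts 0 (map (deskolem_tm \<nu> f) ts) Q) \<in> restored_strong"

lemma funs_restored_strong: "(a, P) \<in> restored_strong \<Longrightarrow> funs P \<subseteq> K"
proof (induction rule: restored_strong.induct)
  case (renamed a P)
  then show ?case
    using funs_deskolem[of \<nu> f P] funs_\<Sigma> by blast
next
  case (reintroduced ts)
  have "funs_tm (deskolem_tm \<nu> f t) \<subseteq> K" if "t \<in> set ts" for t
    using funs_deskolem_tm[of \<nu> f t] reintroduced that by blast
  then show ?case
    using funs_insts[of 0 "map (deskolem_tm \<nu> f) ts" Q] funs_Q by fastforce
qed

lemma name_inject: "\<nu> s = \<nu> t \<Longrightarrow> funs_tm s \<subseteq> K \<Longrightarrow> funs_tm t \<subseteq> K \<Longrightarrow> s = t"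
  using inj_\<nu> by (auto dest: inj_onD)

lemma restored_strong_named:
  assumes "(\<nu> s, P) \<in> restored_strong" and "funs_tm s \<subseteq> K"
  shows "(\<exists>a P\<^sub>0. s = Free a \<and> (a, P\<^sub>0) \<in> \<Sigma> \<and> P = deskolem \<nu> f P\<^sub>0) \<or>
    (\<exists>ts. s = Fun f (rev ts) \<and> P = insts 0 (map (deskolem_tm \<nu> f) ts) Q)"
  using assms(1)
proof cases
  case (renamed a P\<^sub>0)
  then have "s = Free a"
    using assms(2) by (intro name_inject) auto
  then show ?thesis
    using renamed by blast
next
  case (reintroduced ts)
  then have "s = Fun f (rev ts)"
    using assms(2) f_in_K by (intro name_inject) auto
  then show ?thesis
    using reintroduced by blast
qed

lemma single_valued_restored_strong: "single_valued restored_strong"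
proof (rule single_valuedI)
  fix a P P' assume P: "(a, P) \<in> restored_strong" and P': "(a, P') \<in> restored_strong"
  from P obtain s where s: "a = \<nu> s" "funs_tm s \<subseteq> K"
  proof cases
    case (renamed b)
    then show ?thesis using that[of "Free b"] by simp
  next
    case (reintroduced ts)
    then show ?thesis using that[of "Fun f (rev ts)"] f_in_K by auto
  qed
  have "single_valued \<Sigma>"
    using suitable_\<Sigma> by (simp add: suitable_set_def)
  then show "P = P'"
    using restored_strong_named[of s P] restored_strong_named[of s P'] P P' s
    by (auto dest: single_valuedD)
qed

lemma dependencies_restored_strong:
  assumes "(a, b) \<in> dependencies restored_strong"
  shows "\<exists>s t. a = \<nu> s \<and> b = \<nu> t \<and> funs_tm s \<subseteq> K \<and> funs_tm t \<subseteq> K \<and>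
    (s, t) \<in> term_dependency ((dependencies \<Sigma>)\<^sup>+)"
proof -
  obtain P where P: "(a, P) \<in> restored_strong" "b \<in> fv P"
    using assms by (auto simp: dependencies_def)
  from P(1) show ?thesis
  proof cases
    case (renamed c P\<^sub>0)
    then obtain t where t: "b = \<nu> t" "fv_tm t \<subseteq> fv P\<^sub>0" "funs_tm t \<subseteq> funs P\<^sub>0"
      using P(2) fv_deskolem[of b \<nu> f P\<^sub>0] by auto
    have "fv P\<^sub>0 \<subseteq> dependencies \<Sigma> `` {c}"
      using \<open>(c, P\<^sub>0) \<in> \<Sigma>\<close> by (auto simp: dependencies_def)
    then have "(Free c, t) \<in> term_dependency ((dependencies \<Sigma>)\<^sup>+)"
      using t(2) by (auto simp: term_dependency_def)
    then show ?thesis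
      using renamed t funs_\<Sigma>[of c P\<^sub>0] by (intro exI[of _ "Free c"] exI[of _ t]) auto
  next
    case (reintroduced ts)
    then obtain u where u: "u \<in> set ts" "b \<in> fv_tm (deskolem_tm \<nu> f u)"
      using P(2) fv_insts[of 0 "map (deskolem_tm \<nu> f) ts" Q] fv_Q by auto
    then obtain t where t: "b = \<nu> t" "fv_tm t \<subseteq> fv_tm u" "funs_tm t \<subseteq> funs_tm u" "size t \<le> size u"
      using fv_deskolem_tm[OF u(2)] by auto
    have "size t < size (Fun f (rev ts))"
      using size_list_estimation'[of u "rev ts" "size t" size] u(1) t(4) by simp
    then have "(Fun f (rev ts), t) \<in> term_dependency ((dependencies \<Sigma>)\<^sup>+)"
      using u(1) t(2) by (auto simp: term_dependency_def)
    then show ?thesis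
      using reintroduced u(1) t(1,3) f_in_K by (intro exI[of _ "Fun f (rev ts)"] exI[of _ t]) auto
  qed
qed

lemma acyclic_dependencies_restored_strong: "acyclic (dependencies restored_strong)"
proof -
  let ?D = "term_dependency ((dependencies \<Sigma>)\<^sup>+) :: ('f tm \<times> 'f tm) set"
  let ?named = "inv_into {t. funs_tm t \<subseteq> K} \<nu>"
  have "dependencies restored_strong \<subseteq> inv_image ?D ?named"
  proof (rule subrelI)
    fix a b assume "(a, b) \<in> dependencies restored_strong"
    then obtain s t where "a = \<nu> s" "b = \<nu> t" "funs_tm s \<subseteq> K" "funs_tm t \<subseteq> K" "(s, t) \<in> ?D"
      using dependencies_restored_strong by blast
    then show "(a, b) \<in> inv_image ?D ?named"
      using inj_\<nu> by (simp add: inv_into_f_f)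
  qed
  moreover have "acyclic (inv_image ?D ?named)"
    using suitable_\<Sigma>
    by (intro acyclic_inv_image acyclic_term_dependency)
      (simp_all add: suitable_set_def acyclic_def)
  ultimately show ?thesis
    by (rule acyclic_subset[rotated])
qed

lemma suitable_restored_strong: "suitable_set restored_strong"
  using single_valued_restored_strong acyclic_dependencies_restored_strong
  by (simp add: suitable_set_def)

text \<open>An occurrence of \<open>B\<close> with polarity \<open>p\<close> in the given derivation is replaced by \<open>G\<close>. In an inner
  restoration \<open>G\<close> does not start with a reintroduced quantifier.\<close>

inductive restoration and inner_restoration ::
  "bool \<Rightarrow> ('f, 'p) fm \<Rightarrow> ('f, 'p) fm \<Rightarrow> bool" where
  inner: "inner_restoration p B G \<Longrightarrow> restoration p B G"
| strong_All: "(a, All G) \<in> restored_strong \<Longrightarrow> inner_restoration True B (inst 0 (Free a) G) \<Longrightarrow>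
    restoration True B (All G)"
| strong_Ex: "(a, Ex G) \<in> restored_strong \<Longrightarrow> inner_restoration False B (inst 0 (Free a) G) \<Longrightarrow>
    restoration False B (Ex G)"
| untouched: "skolem_closed f B \<Longrightarrow> inner_restoration p B (deskolem \<nu> f B)"
| inner_And: "restoration p B G \<Longrightarrow> restoration p C H \<Longrightarrow> inner_restoration p (And B C) (And G H)"
| inner_Or: "restoration p B G \<Longrightarrow> restoration p C H \<Longrightarrow> inner_restoration p (Or B C) (Or G H)"
| inner_Imp: "restoration (\<not> p) B G \<Longrightarrow> restoration p C H \<Longrightarrow> inner_restoration p (Imp B C) (Imp G H)"
| weak_All: "(\<And>t. lc_tm 0 t \<Longrightarrow> funs_tm t \<subseteq> K \<Longrightarrow>
      restoration False (inst 0 t B) (inst 0 (deskolem_tm \<nu> f t) G)) \<Longrightarrow>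
    inner_restoration False (All B) (All G)"
| weak_Ex: "(\<And>t. lc_tm 0 t \<Longrightarrow> funs_tm t \<subseteq> K \<Longrightarrow>
      restoration True (inst 0 t B) (inst 0 (deskolem_tm \<nu> f t) G)) \<Longrightarrow>
    inner_restoration True (Ex B) (Ex G)"

lemma restoration_insts:
  assumes "f \<notin> funs A" "fv A = {}" "list_all (lc_tm 0) ts"
  shows "restoration p (insts k ts A) (insts k (map (deskolem_tm \<nu> f) ts) A)"
  using untouched[OF skolem_closed_insts[of f A ts k]] assms
  by (simp add: inner deskolem_insts deskolem_id skolem_closed_fresh)

lemma inner_restoration_skolem_instance:
  assumes "f \<notin> funs A" "fv A = {}" "list_all (lc_tm 0) ts"
  shows "inner_restoration p (insts 0 ts (inst 0 (skolem_tm (length ts) f) A))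
    (inst 0 (Free (\<nu> (Fun f (rev ts)))) (insts 1 (map (deskolem_tm \<nu> f) ts) A))"
proof -
  let ?s = "Fun f (rev ts)"
  have closed: "list_all (lc_tm 0) (?s # ts)"
    using assms(3) by simp
  have "deskolem \<nu> f (insts 0 (?s # ts) A) =
      insts 0 (Free (\<nu> ?s) # map (deskolem_tm \<nu> f) ts) A"
    using deskolem_insts[OF skolem_closed_fresh[OF assms(1)] closed] assms(1,2)
    by (simp add: deskolem_id)
  also have "\<dots> = inst 0 (Free (\<nu> ?s)) (insts 1 (map (deskolem_tm \<nu> f) ts) A)"
    using assms(3) by (simp add: inst_insts list_all_iff lc_deskolem_tm)
  finally show ?thesis
    using untouched[OF skolem_closed_insts[OF skolem_closed_fresh[OF assms(1)] closed]]
      insts_skolem_instance[OF assms(3)]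
    by metis
qed

lemma restoration_skolem_All:
  assumes "Q = All A" and "f \<notin> funs A" and "list_all (lc_tm 0) ts" and "\<forall>t\<in>set ts. funs_tm t \<subseteq> K"
  shows "restoration True (insts 0 ts (inst 0 (skolem_tm (length ts) f) A))
    (All (insts 1 (map (deskolem_tm \<nu> f) ts) A))"
proof (rule strong_All)
  show "(\<nu> (Fun f (rev ts)), All (insts 1 (map (deskolem_tm \<nu> f) ts) A)) \<in> restored_strong"
    using assms(1) reintroduced[OF assms(4)] by simp
qed (use assms fv_Q in \<open>intro inner_restoration_skolem_instance; simp\<close>)

lemma restoration_skolem_Ex:
  assumes "Q = Ex A" and "f \<notin> funs A" and "list_all (lc_tm 0) ts" and "\<forall>t\<in>set ts. funs_tm t \<subseteq> K"
  shows "restoration False (insts 0 ts (inst 0 (skolem_tm (length ts) f) A))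
    (Ex (insts 1 (map (deskolem_tm \<nu> f) ts) A))"
proof (rule strong_Ex)
  show "(\<nu> (Fun f (rev ts)), Ex (insts 1 (map (deskolem_tm \<nu> f) ts) A)) \<in> restored_strong"
    using assms(1) reintroduced[OF assms(4)] by simp
qed (use assms fv_Q in \<open>intro inner_restoration_skolem_instance; simp\<close>)

lemma restoration_insts_All:
  assumes "list_all (lc_tm 0) ts"
    and "\<And>t. lc_tm 0 t \<Longrightarrow> funs_tm t \<subseteq> K \<Longrightarrow>
      restoration False (insts 0 (t # ts) B) (insts 0 (map (deskolem_tm \<nu> f) (t # ts)) A)"
  shows "restoration False (insts 0 ts (All B)) (insts 0 (map (deskolem_tm \<nu> f) ts) (All A))"
proof -
  have "restoration False (inst 0 t (insts 1 ts B))
      (inst 0 (deskolem_tm \<nu> f t) (insts 1 (map (deskolem_tm \<nu> f) ts) A))"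
    if "lc_tm 0 t" "funs_tm t \<subseteq> K" for t
    using assms that by (simp add: inst_insts list_all_iff lc_deskolem_tm)
  then show ?thesis
    by (simp add: inner weak_All)
qed

lemma restoration_insts_Ex:
  assumes "list_all (lc_tm 0) ts"
    and "\<And>t. lc_tm 0 t \<Longrightarrow> funs_tm t \<subseteq> K \<Longrightarrow>
      restoration True (insts 0 (t # ts) B) (insts 0 (map (deskolem_tm \<nu> f) (t # ts)) A)"
  shows "restoration True (insts 0 ts (Ex B)) (insts 0 (map (deskolem_tm \<nu> f) ts) (Ex A))"
proof -
  have "restoration True (inst 0 t (insts 1 ts B))
      (inst 0 (deskolem_tm \<nu> f t) (insts 1 (map (deskolem_tm \<nu> f) ts) A))"
    if "lc_tm 0 t" "funs_tm t \<subseteq> K" for t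
    using assms that by (simp add: inst_insts list_all_iff lc_deskolem_tm)
  then show ?thesis
    by (simp add: inner weak_Ex)
qed

lemma restoration_skolem_first:
  assumes "has_strong p A" and "first_strong p A = Q" and "f \<notin> funs A" and "fv A = {}"
    and "list_all (lc_tm 0) ts" and "\<forall>t\<in>set ts. funs_tm t \<subseteq> K"
  shows "restoration p (insts 0 ts (skolem_first p (length ts) f A))
    (insts 0 (map (deskolem_tm \<nu> f) ts) A)"
  using assms
proof (induction A arbitrary: p ts)
  case (All A)
  show ?case
  proof (cases p)
    case True
    have "restoration True (insts 0 ts (inst 0 (skolem_tm (length ts) f) A))
        (All (insts 1 (map (deskolem_tm \<nu> f) ts) A))"
      using All.prems True by (intro restoration_skolem_All) auto
    then show ?thesis
      using True by simp
  next
    case False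
    then show ?thesis
      using All.IH[of False "_ # ts"] All.prems
      by (simp add: restoration_insts_All del: insts_simps)
  qed
next
  case (Ex A)
  show ?case
  proof (cases p)
    case False
    have "restoration False (insts 0 ts (inst 0 (skolem_tm (length ts) f) A))
        (Ex (insts 1 (map (deskolem_tm \<nu> f) ts) A))"
      using Ex.prems False by (intro restoration_skolem_Ex) auto
    then show ?thesis
      using False by simp
  next
    case True
    then show ?thesis
      using Ex.IH[of True "_ # ts"] Ex.prems
      by (simp add: restoration_insts_Ex del: insts_simps)
  qed
qed (simp_all add: inner inner_And inner_Or inner_Imp restoration_insts split: if_splits)

lemma lc_restoration:
  "restoration p B G \<Longrightarrow> lc 0 B \<Longrightarrow> lc 0 G"
  "inner_restoration p B G \<Longrightarrow> lc 0 B \<Longrightarrow> lc 0 G"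
proof (induction rule: restoration_inner_restoration.inducts)
  case (weak_All B G)
  have "lc_tm 0 (Free 0)" "funs_tm (Free 0) \<subseteq> K"
    by simp_all
  then show ?case
    using weak_All.IH[of "Free 0"] weak_All.prems by (simp add: lc_inst)
next
  case (weak_Ex B G)
  have "lc_tm 0 (Free 0)" "funs_tm (Free 0) \<subseteq> K"
    by simp_all
  then show ?case
    using weak_Ex.IH[of "Free 0"] weak_Ex.prems by (simp add: lc_inst)
qed (simp_all add: lc_deskolem lc_inst)

lemma inner_restoration_atomD: "inner_restoration p A G \<Longrightarrow> is_atom A \<Longrightarrow> G = deskolem \<nu> f A"
  by (erule inner_restoration.cases) auto

lemma inner_restoration_BotD: "inner_restoration p Bot G \<Longrightarrow> G = Bot"
  by (erule inner_restoration.cases) auto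

lemma inner_restoration_AndE:
  assumes "inner_restoration p (And B C) G"
  obtains B' C' where "G = And B' C'" "restoration p B B'" "restoration p C C'"
  using assms by (cases rule: inner_restoration.cases) (auto intro: inner untouched)

lemma inner_restoration_OrE:
  assumes "inner_restoration p (Or B C) G"
  obtains B' C' where "G = Or B' C'" "restoration p B B'" "restoration p C C'"
  using assms by (cases rule: inner_restoration.cases) (auto intro: inner untouched)

lemma inner_restoration_ImpE:
  assumes "inner_restoration p (Imp B C) G"
  obtains B' C' where "G = Imp B' C'" "restoration (\<not> p) B B'" "restoration p C C'"
  using assms by (cases rule: inner_restoration.cases) (auto intro: inner untouched)

lemma restoration_untouched_inst:
  "skolem_closed f B \<Longrightarrow> lc_tm 0 t \<Longrightarrow>
    restoration p (inst k t B) (inst k (deskolem_tm \<nu> f t) (deskolem \<nu> f B))"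
  using untouched[OF skolem_closed_inst] by (simp add: inner deskolem_inst)

lemma inner_restoration_weak_AllE:
  assumes "inner_restoration False (All B) G" and "lc_tm 0 t" and "funs_tm t \<subseteq> K"
  obtains B' t' where "G = All B'" "lc_tm 0 t'" "funs_tm t' \<subseteq> K"
    "restoration False (inst 0 t B) (inst 0 t' B')"
proof -
  obtain B' where "G = All B'" "restoration False (inst 0 t B) (inst 0 (deskolem_tm \<nu> f t) B')"
    using assms by (cases rule: inner_restoration.cases) (auto intro: restoration_untouched_inst)
  then show ?thesis
    using that assms(2,3) lc_deskolem_tm funs_deskolem_tm by (metis order.trans)
qed

lemma inner_restoration_weak_ExE:
  assumes "inner_restoration True (Ex B) G" and "lc_tm 0 t" and "funs_tm t \<subseteq> K"
  obtains B' t' where "G = Ex B'" "lc_tm 0 t'" "funs_tm t' \<subseteq> K"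
    "restoration True (inst 0 t B) (inst 0 t' B')"
proof -
  obtain B' where "G = Ex B'" "restoration True (inst 0 t B) (inst 0 (deskolem_tm \<nu> f t) B')"
    using assms by (cases rule: inner_restoration.cases) (auto intro: restoration_untouched_inst)
  then show ?thesis
    using that assms(2,3) lc_deskolem_tm funs_deskolem_tm by (metis order.trans)
qed

lemma inner_restoration_strong_AllE:
  assumes "inner_restoration True (All B) G" and "(a, All B) \<in> \<Sigma>"
  obtains B' b where "G = All B'" "(b, All B') \<in> restored_strong"
    "restoration True (inst 0 (Free a) B) (inst 0 (Free b) B')"
  using assms renamed[OF assms(2)] restoration_untouched_inst[of B "Free a" True 0]
  by (cases rule: inner_restoration.cases) auto

lemma inner_restoration_strong_ExE:
  assumes "inner_restoration False (Ex B) G" and "(a, Ex B) \<in> \<Sigma>"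
  obtains B' b where "G = Ex B'" "(b, Ex B') \<in> restored_strong"
    "restoration False (inst 0 (Free a) B) (inst 0 (Free b) B')"
  using assms renamed[OF assms(2)] restoration_untouched_inst[of B "Free a" False 0]
  by (cases rule: inner_restoration.cases) auto

abbreviation restored_sequent :: "('f, 'p) sequent \<Rightarrow> ('f, 'p) sequent \<Rightarrow> bool" where
  "restored_sequent \<equiv> rel_seq restoration"

lemma restored_sequent_inner: "rel_seq inner_restoration S S' \<Longrightarrow> restored_sequent S S'"
  by (erule rel_seq_mono) (rule inner)

lemma restored_propositional_inference:
  assumes "lk_inference r Ss S" and "\<not> quantifier_rule r" and "r \<noteq> Cut"
    and rel: "rel_seq inner_restoration S S'"
  shows "\<exists>Ss'. lk_inference r Ss' S' \<and> list_all2 restored_sequent Ss Ss'"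
proof -
  note elims = rel_seq_elims inner_restoration_AndE inner_restoration_OrE
    inner_restoration_ImpE
  from assms(1) show ?thesis
  proof (cases rule: lk_inference_cases)
    case (AxAtom A)
    then obtain G H where "S' = ({#G#} \<turnstile> {#H#})" "inner_restoration False A G"
        "inner_restoration True A H"
      using rel by (auto elim!: elims)
    moreover have "is_atom (deskolem \<nu> f A)"
      using AxAtom by (cases A) auto
    ultimately show ?thesis
      using AxAtom inner_restoration_atomD[of _ A] lk_AxAtom[of "deskolem \<nu> f A"] by auto
  next
    case AxBot
    then have "S' = ({#Bot#} \<turnstile> {#})"
      using rel inner_restoration_BotD by (auto elim!: elims)
    then show ?thesis
      using AxBot lk_AxBot by auto
  qed (use rel assms(2,3) in \<open>auto simp: quantifier_rule_def elim!: elims\<close>,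
      (intro exI conjI, rule lk_inference.intros,
        force intro: rel_seq_intros restored_sequent_inner inner)+)
qed

lemma restored_weak_inference:
  assumes "lk_inference r Ss S" and "weak_quantifier_rule r" and "permitted \<Sigma> K r"
    and rel: "rel_seq inner_restoration S S'"
  shows "\<exists>r' Ss'. lk_inference r' Ss' S' \<and> permitted restored_strong K r' \<and>
    list_all2 restored_sequent Ss Ss'"
  using assms(1)
proof (cases rule: lk_inference_cases)
  case (AllL t A \<Gamma> \<Delta>)
  then obtain G t' \<Gamma>' \<Delta>' where G: "S' = (add_mset (All G) \<Gamma>' \<turnstile> \<Delta>')"
      "lc_tm 0 t'" "funs_tm t' \<subseteq> K" "restoration False (inst 0 t A) (inst 0 t' G)"
      "restored_sequent (\<Gamma> \<turnstile> \<Delta>) (\<Gamma>' \<turnstile> \<Delta>')"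
    using rel assms(3)
    by (auto elim!: rel_seq_elims inner_restoration_weak_AllE dest: restored_sequent_inner)
  show ?thesis
    unfolding AllL G(1)
    by (intro exI conjI, rule lk_AllL[OF G(2)]) (use G in \<open>auto intro: rel_seq_intros\<close>)
next
  case (ExR t A \<Gamma> \<Delta>)
  then obtain G t' \<Gamma>' \<Delta>' where G: "S' = (\<Gamma>' \<turnstile> add_mset (Ex G) \<Delta>')"
      "lc_tm 0 t'" "funs_tm t' \<subseteq> K" "restoration True (inst 0 t A) (inst 0 t' G)"
      "restored_sequent (\<Gamma> \<turnstile> \<Delta>) (\<Gamma>' \<turnstile> \<Delta>')"
    using rel assms(3)
    by (auto elim!: rel_seq_elims inner_restoration_weak_ExE dest: restored_sequent_inner)
  show ?thesis
    unfolding ExR G(1)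
    by (intro exI conjI, rule lk_ExR[OF G(2)]) (use G in \<open>auto intro: rel_seq_intros\<close>)
qed (use assms(2) in auto)

lemma restored_strong_inference:
  assumes "lk_inference r Ss S" and "strong_quantifier_rule r \<noteq> None" and "permitted \<Sigma> K r"
    and rel: "rel_seq inner_restoration S S'"
  shows "\<exists>r' Ss'. lk_inference r' Ss' S' \<and> permitted restored_strong K r' \<and>
    list_all2 restored_sequent Ss Ss'"
  using assms(1)
proof (cases rule: lk_inference_cases)
  case (AllR A a \<Gamma> \<Delta>)
  then obtain G b \<Gamma>' \<Delta>' where G: "S' = (\<Gamma>' \<turnstile> add_mset (All G) \<Delta>')"
      "(b, All G) \<in> restored_strong" "restoration True (inst 0 (Free a) A) (inst 0 (Free b) G)"
      "restored_sequent (\<Gamma> \<turnstile> \<Delta>) (\<Gamma>' \<turnstile> \<Delta>')"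
    using rel assms(3)
    by (auto elim!: rel_seq_elims inner_restoration_strong_AllE
        dest: restored_sequent_inner)
  show ?thesis
    unfolding AllR G(1)
    by (intro exI conjI, rule lk_AllR) (use G in \<open>auto intro: rel_seq_intros\<close>)
next
  case (ExL A a \<Gamma> \<Delta>)
  then obtain G b \<Gamma>' \<Delta>' where G: "S' = (add_mset (Ex G) \<Gamma>' \<turnstile> \<Delta>')"
      "(b, Ex G) \<in> restored_strong" "restoration False (inst 0 (Free a) A) (inst 0 (Free b) G)"
      "restored_sequent (\<Gamma> \<turnstile> \<Delta>) (\<Gamma>' \<turnstile> \<Delta>')"
    using rel assms(3)
    by (auto elim!: rel_seq_elims inner_restoration_strong_ExE
        dest: restored_sequent_inner)
  show ?thesis
    unfolding ExL G(1)
    by (intro exI conjI, rule lk_ExL) (use G in \<open>auto intro: rel_seq_intros\<close>)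
qed (use assms(2) in auto)

lemma restored_inference:
  assumes "lk_inference r Ss S" and "permitted \<Sigma> K r"
    and "rel_seq inner_restoration S S'"
  shows "\<exists>r' Ss'. lk_inference r' Ss' S' \<and> permitted restored_strong K r' \<and>
    list_all2 restored_sequent Ss Ss'"
proof -
  consider (weak) "weak_quantifier_rule r" | (strong) "strong_quantifier_rule r \<noteq> None"
    | (propositional) "\<not> quantifier_rule r"
    by (auto simp: quantifier_rule_def)
  then show ?thesis
  proof cases
    case weak
    then show ?thesis
      using assms by (intro restored_weak_inference)
  next
    case strong
    then show ?thesis
      using assms by (intro restored_strong_inference)
  next
    case propositional
    then have "permitted restored_strong K r" "r \<noteq> Cut"
      using assms(2) by (cases r; simp add: quantifier_rule_def)+
    then show ?thesis
      using restored_propositional_inference[OF assms(1) propositional _ assms(3)] by auto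
  qed
qed

lemma lc_rel_mset_inner_restoration:
  assumes "rel_mset (inner_restoration p) M N" and "\<forall>B\<in>#M. lc 0 B"
  shows "\<forall>G\<in>#N. lc 0 G"
proof
  fix G assume "G \<in># N"
  then obtain B where "B \<in># M" "inner_restoration p B G"
    using rel_setD2[OF rel_funD[OF multiset.set_transfer assms(1)]] by auto
  then show "lc 0 G"
    using assms(2) lc_restoration(2) by simp
qed

lemma lj_sequent_inner_restoration:
  assumes "lj_sequent S" and "rel_seq inner_restoration S S'"
  shows "lj_sequent S'"
proof -
  obtain \<Gamma> \<Delta> \<Gamma>' \<Delta>' where S: "S = (\<Gamma> \<turnstile> \<Delta>)" "S' = (\<Gamma>' \<turnstile> \<Delta>')"
    by (cases S; cases S')
  then have rel: "rel_mset (inner_restoration False) \<Gamma> \<Gamma>'" "rel_mset (inner_restoration True) \<Delta> \<Delta>'"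
    using assms(2) by (simp_all add: rel_seq.simps)
  then show ?thesis
    using assms(1) S rel_mset_size[OF rel(2)]
      lc_rel_mset_inner_restoration[OF rel(1)] lc_rel_mset_inner_restoration[OF rel(2)]
    by (auto simp: lj_sequent_def)
qed

lemma derivable_restoration:
  assumes "restored_sequent (\<Gamma> \<turnstile> \<Delta>) (\<Gamma>' \<turnstile> \<Delta>')"
    and derivable_inner: "\<And>\<Gamma>\<^sub>0 \<Delta>\<^sub>0. rel_seq inner_restoration (\<Gamma> \<turnstile> \<Delta>) (\<Gamma>\<^sub>0 \<turnstile> \<Delta>\<^sub>0) \<Longrightarrow>
      derivable_within restored_strong K (\<Gamma>\<^sub>0 \<turnstile> \<Delta>\<^sub>0)"
  shows "derivable_within restored_strong K (\<Gamma>' \<turnstile> \<Delta>')"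
proof -
  have rel: "rel_mset (restoration False) \<Gamma> \<Gamma>'" "rel_mset (restoration True) \<Delta> \<Delta>'"
    using assms(1) by (simp_all add: rel_seq.simps)
  have succedent_restored: "derivable_within restored_strong K (\<Gamma>\<^sub>0 \<turnstile> \<Delta>')"
    if \<Gamma>\<^sub>0: "rel_mset (inner_restoration False) \<Gamma> \<Gamma>\<^sub>0" for \<Gamma>\<^sub>0
    using rel(2)
  proof (rule rel_mset_replace)
    show "derivable_within restored_strong K (\<Gamma>\<^sub>0 \<turnstile> \<Delta>\<^sub>0)"
      if "rel_mset (inner_restoration True) \<Delta> \<Delta>\<^sub>0" for \<Delta>\<^sub>0
      using \<Gamma>\<^sub>0 that by (intro derivable_inner) (simp add: rel_seq.simps)
    show "derivable_within restored_strong K (\<Gamma>\<^sub>0 \<turnstile> add_mset G \<Delta>\<^sub>0)"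
      if "restoration True B G" "\<And>H. inner_restoration True B H \<Longrightarrow>
        derivable_within restored_strong K (\<Gamma>\<^sub>0 \<turnstile> add_mset H \<Delta>\<^sub>0)" for B G \<Delta>\<^sub>0
      using that(1) by (cases rule: restoration.cases) (auto intro: that(2) derivable_AllR)
  qed
  show ?thesis
    using rel(1)
  proof (rule rel_mset_replace)
    show "derivable_within restored_strong K (\<Gamma>\<^sub>0 \<turnstile> \<Delta>')"
      if "rel_mset (inner_restoration False) \<Gamma> \<Gamma>\<^sub>0" for \<Gamma>\<^sub>0
      using that by (rule succedent_restored)
    show "derivable_within restored_strong K (add_mset G \<Gamma>\<^sub>0 \<turnstile> \<Delta>')"
      if "restoration False B G" "\<And>H. inner_restoration False B H \<Longrightarrow>
        derivable_within restored_strong K (add_mset H \<Gamma>\<^sub>0 \<turnstile> \<Delta>')" for B G \<Gamma>\<^sub>0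
      using that(1) by (cases rule: restoration.cases) (auto intro: that(2) derivable_ExL)
  qed
qed

lemma derivable_restored_sequent:
  assumes "derivable_within \<Sigma> K S" and "restored_sequent S S'"
  shows "derivable_within restored_strong K S'"
  using assms
proof (induction arbitrary: S' rule: derivable_within.induct)
  case (infer r Ss S)
  obtain \<Gamma> \<Delta> \<Gamma>' \<Delta>' where S: "S = (\<Gamma> \<turnstile> \<Delta>)" "S' = (\<Gamma>' \<turnstile> \<Delta>')"
    by (cases S; cases S')
  have "derivable_within restored_strong K T" if T: "rel_seq inner_restoration S T" for T
  proof -
    obtain r' Ss' where r': "lk_inference r' Ss' T" "permitted restored_strong K r'"
        and Ss': "list_all2 restored_sequent Ss Ss'"
      using restored_inference[OF infer.hyps(1,2) T] by auto
    have "derivable_within restored_strong K T'" if "T' \<in> set Ss'" for T'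
      using rel_setD2[OF rel_funD[OF list.set_transfer Ss'] that] infer.IH by blast
    with r' lj_sequent_inner_restoration[OF infer.hyps(3) T] show ?thesis
      by (rule derivable_within.infer)
  qed
  then show ?case
    using infer.prems S derivable_restoration[of \<Gamma> \<Delta> \<Gamma>' \<Delta>']
    by simp
qed

end

definition skolem_step :: "'f \<Rightarrow> ('f, 'p) fm \<Rightarrow> bool \<Rightarrow> ('f, 'p) fm \<Rightarrow> ('f, 'p) fm \<Rightarrow> bool" where
  "skolem_step f Q p B A \<longleftrightarrow> fv A = {} \<and> f \<notin> funs A \<and>
    (B = A \<or> has_strong p A \<and> first_strong p A = Q \<and> B = skolem_first p 0 f A)"

lemma skolem_step_refl: "skolem_step f Q p A A \<longleftrightarrow> fv A = {} \<and> f \<notin> funs A"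
  by (auto simp: skolem_step_def)

lemma (in skolem_elimination) restoration_skolem_step:
  assumes "skolem_step f Q p B A"
  shows "restoration p B A"
proof -
  have "restoration p A A"
    using assms restoration_insts[of A "[]" p 0] by (simp add: skolem_step_def)
  moreover have "restoration p (skolem_first p 0 f A) A" if "has_strong p A" "first_strong p A = Q"
    using assms that restoration_skolem_first[of p A "[]"] by (simp add: skolem_step_def)
  ultimately show ?thesis
    using assms by (auto simp: skolem_step_def)
qed

lemma suitably_derivable_skolem_step:
  fixes S S' :: "('f, 'p) sequent"
  assumes "suitably_derivable S" and "rel_seq (skolem_step f Q) S S'" and "fv Q = {}"
  shows "suitably_derivable S'"
proof -
  obtain \<Sigma> K where \<Sigma>: "suitable_set \<Sigma>" "finite K" "\<forall>(a, P)\<in>\<Sigma>. funs P \<subseteq> K"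
      "derivable_within \<Sigma> K S"
    using assms(1) unfolding suitably_derivable_def by auto
  let ?K = "insert f (K \<union> funs Q)"
  have finite_K: "finite ?K"
    using \<Sigma>(2) by (simp add: finite_funs)
  obtain \<nu> :: "'f tm \<Rightarrow> nat" where "inj_on \<nu> {t. funs_tm t \<subseteq> ?K}"
    using ex_term_naming[OF finite_K] by auto
  then interpret skolem_elimination \<nu> f ?K Q \<Sigma>
    using \<Sigma>(1,3) assms(3) by unfold_locales auto
  have "derivable_within \<Sigma> ?K S"
    using \<Sigma>(4) by (rule derivable_within_mono) auto
  moreover have "restored_sequent S S'"
    using assms(2) restoration_skolem_step by (rule rel_seq_mono)
  ultimately have "derivable_within restored_strong ?K S'"
    by (rule derivable_restored_sequent)
  then show ?thesis
    using suitable_restored_strong funs_restored_strong finite_K unfolding suitably_derivable_def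
    by (intro exI[of _ restored_strong] exI[of _ ?K]) auto
qed

section \<open>Skolemization of sequents\<close>

lemma Conj_Cons: "Conj (A # As) = (if As = [] then A else And A (Conj As))"
  by (cases As) auto

lemma Disj_Cons: "Disj (A # As) = (if As = [] then A else Or A (Disj As))"
  by (cases As) auto

lemma fv_junction: "J \<in> {Conj, Disj} \<Longrightarrow> fv (J As) = (\<Union>A\<in>set As. fv A)"
  by (induction As) (auto simp: Conj_Cons Disj_Cons split: if_splits)

lemma funs_junction: "J \<in> {Conj, Disj} \<Longrightarrow> funs (J As) = (\<Union>A\<in>set As. funs A)"
  by (induction As) (auto simp: Conj_Cons Disj_Cons split: if_splits)

lemma junction_inject:
  "length As = length Bs \<Longrightarrow> J \<in> {Conj, Disj} \<Longrightarrow> J As = J Bs \<longleftrightarrow> As = Bs"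
  by (induction As Bs rule: list_induct2) (auto simp: Conj_Cons Disj_Cons split: if_splits)

lemma skolem_first_junction:
  assumes "J \<in> {Conj, Disj}" and "has_strong p (J As)"
    and "\<forall>A\<in>set As. fv A = {} \<and> f \<notin> funs A"
  shows "\<exists>Bs. skolem_first p 0 f (J As) = J Bs \<and>
    list_all2 (skolem_step f (first_strong p (J As)) p) Bs As"
  using assms(2,3)
proof (induction As)
  case Nil
  then show ?case
    using assms(1) by auto
next
  case (Cons A As)
  show ?case
  proof (cases "has_strong p A")
    case True
    then have "skolem_first p 0 f (J (A # As)) = J (skolem_first p 0 f A # As)"
      and "first_strong p (J (A # As)) = first_strong p A"
      using assms(1) by (auto simp: Conj_Cons Disj_Cons)
    then show ?thesis
      using True Cons.prems
      by (intro exI[of _ "skolem_first p 0 f A # As"])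
        (simp add: skolem_step_refl list_all2_same, simp add: skolem_step_def)
  next
    case False
    then have "As \<noteq> []" "has_strong p (J As)"
      using Cons.prems assms(1) by (auto simp: Conj_Cons Disj_Cons split: if_splits)
    then obtain Bs where Bs: "skolem_first p 0 f (J As) = J Bs"
        "list_all2 (skolem_step f (first_strong p (J As)) p) Bs As" "Bs \<noteq> []"
      using Cons by auto
    then have "skolem_first p 0 f (J (A # As)) = J (A # Bs)"
      and "first_strong p (J (A # As)) = first_strong p (J As)"
      using assms(1) False \<open>As \<noteq> []\<close> by (auto simp: Conj_Cons Disj_Cons)
    then show ?thesis
      using Bs Cons.prems by (intro exI[of _ "A # Bs"]) (simp add: skolem_step_refl)
  qed
qed

lemma skolem_first_sequent_formula:
  assumes "has_strong True (Imp (Conj As) (Disj Bs))"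
    and fresh: "\<forall>A\<in>set As \<union> set Bs. fv A = {} \<and> f \<notin> funs A"
    and Q: "Q = first_strong True (Imp (Conj As) (Disj Bs))"
  obtains As' Bs' where
    "skolem_first True 0 f (Imp (Conj As) (Disj Bs)) = Imp (Conj As') (Disj Bs')"
    "list_all2 (skolem_step f Q False) As' As" "list_all2 (skolem_step f Q True) Bs' Bs"
proof (cases "has_strong False (Conj As)")
  case True
  then obtain As' where "skolem_first False 0 f (Conj As) = Conj As'"
      "list_all2 (skolem_step f Q False) As' As"
    using skolem_first_junction[of Conj False As f] fresh Q by auto
  then show ?thesis
    using that[of As' Bs] True fresh by (simp add: skolem_step_refl list_all2_same)
next
  case False
  then obtain Bs' where "skolem_first True 0 f (Disj Bs) = Disj Bs'"
      "list_all2 (skolem_step f Q True) Bs' Bs"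
    using skolem_first_junction[of Disj True Bs f] assms by auto
  then show ?thesis
    using that[of As Bs'] False fresh by (simp add: skolem_step_refl list_all2_same)
qed

lemma rel_mset_mset: "list_all2 R xs ys \<Longrightarrow> rel_mset R (mset xs) (mset ys)"
  by (auto simp: rel_mset_def)

lemma suitably_derivable_skolem_iter:
  assumes "skolem_iter U F G" and "F = Imp (Conj As) (Disj Bs)" and "G = Imp (Conj Cs) (Disj Ds)"
    and "length Cs = length As" and "length Ds = length Bs"
    and "fv F = {}" and "funs F \<subseteq> U" and "suitably_derivable (mset Cs \<turnstile> mset Ds)"
  shows "suitably_derivable (mset As \<turnstile> mset Bs)"
  using assms
proof (induction arbitrary: As Bs rule: skolem_iter.induct)
  case (1 F U)
  then show ?case
    by (simp add: junction_inject[of _ _ Conj] junction_inject[of _ _ Disj])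
next
  case (2 F f U G)
  note F = \<open>F = Imp (Conj As) (Disj Bs)\<close> and closed = \<open>fv F = {}\<close> and used = \<open>funs F \<subseteq> U\<close>
  let ?Q = "first_strong True F"
  have "\<forall>A\<in>set As \<union> set Bs. fv A = {} \<and> f \<notin> funs A"
    using F closed used \<open>f \<notin> U\<close>
    by (auto simp: fv_junction[of Conj] fv_junction[of Disj] funs_junction[of Conj]
        funs_junction[of Disj])
  then obtain As' Bs' where F': "skolem_first True 0 f F = Imp (Conj As') (Disj Bs')"
      and As': "list_all2 (skolem_step f ?Q False) As' As"
      and Bs': "list_all2 (skolem_step f ?Q True) Bs' Bs"
    using skolem_first_sequent_formula[of As Bs f ?Q] F \<open>has_strong True F\<close> by blast
  have "suitably_derivable (mset As' \<turnstile> mset Bs')"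
  proof (rule "2.IH"[OF F'])
    show "length Cs = length As'" "length Ds = length Bs'"
      using As' Bs' "2.prems" by (simp_all add: list_all2_lengthD)
    show "fv (skolem_first True 0 f F) = {}" "funs (skolem_first True 0 f F) \<subseteq> insert f U"
      using fv_skolem_first[of True 0 f F] funs_skolem_first[of True 0 f F] closed used by auto
  qed (use "2.prems" in auto)
  moreover have "rel_seq (skolem_step f ?Q) (mset As' \<turnstile> mset Bs') (mset As \<turnstile> mset Bs)"
    using As' Bs' by (simp add: rel_seq.simps rel_mset_mset)
  moreover have "fv ?Q = {}"
    using fv_first_strong[of True F] closed by simp
  ultimately show ?case
    by (rule suitably_derivable_skolem_step)
qed

theorem mainTheorem7:
  fixes \<Gamma> \<Delta> \<Pi> \<Lambda> :: "('f, 'p) fm multiset"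
  assumes "seq_skolemization (\<Gamma> \<turnstile> \<Delta>) (\<Pi> \<turnstile> \<Lambda>)"
    and "\<exists>\<pi>. LJpp_proof \<pi> \<and> end_sequent \<pi> = (\<Pi> \<turnstile> \<Lambda>) \<and> cut_free \<pi> \<and> atomic_axioms \<pi>"
  shows "\<exists>\<pi>. LJpp_proof \<pi> \<and> end_sequent \<pi> = (\<Gamma> \<turnstile> \<Delta>) \<and> cut_free \<pi>"
proof -
  obtain As Bs Cs Ds where seqs: "\<Gamma> = mset As" "\<Delta> = mset Bs" "\<Pi> = mset Cs" "\<Lambda> = mset Ds"
    and lengths: "length Cs = length As" "length Ds = length Bs"
    and skolem: "skolemization (Imp (Conj As) (Disj Bs)) (Imp (Conj Cs) (Disj Ds))"
    using assms(1) by (auto simp: seq_skolemization_def)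
  let ?F = "Imp (Conj As) (Disj Bs)"
  have closed: "fv ?F = {}" and iter: "skolem_iter (funs ?F) ?F (Imp (Conj Cs) (Disj Ds))"
    using skolem by (simp_all add: skolemization_def closed_fm_def)
  have "suitably_derivable (mset Cs \<turnstile> mset Ds)"
    using assms(2) seqs suitably_derivable_of_proof by metis
  then have "suitably_derivable (\<Gamma> \<turnstile> \<Delta>)"
    using suitably_derivable_skolem_iter[OF iter refl refl lengths closed] seqs by simp
  moreover have "fv_seq (\<Gamma> \<turnstile> \<Delta>) = {}"
    using closed seqs by (simp add: fv_junction[of Conj] fv_junction[of Disj])
  ultimately show ?thesis
    by (rule proof_of_suitably_derivable)
qed

end
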